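(* (Inversion of the Miura transform.) Let $q\in L^1_{\mathrm{loc}}(\mathbb{R})$ be real valued and let $y_0\in\mathbb{R}$. Then there is a unique function $\alpha:\mathbb{R}\to\mathbb{R}\cup\{\infty\}\subset\widehat{\mathbb{C}}$ such that $\alpha(0)=y_0$, $\mathcal{S}\alpha\in AC_{\mathrm{loc}}(\mathbb{R},S^2)$, and $q=\alpha^2+\alpha'$ almost everywhere, and it is given by $$\alpha=\frac{y_0C_{1,q}+S_{q,1}}{y_0S_{1,q}+C_{q,1}},$$ where the value is $\infty$ at points where the denominator vanishes.
   Context: $L^1_{\mathrm{loc}}(\mathbb{R})$ denotes the space of locally integrable complex valued functions on $\mathbb{R}$; $AC_{\mathrm{loc}}(\mathbb{R},S^2)$ the locally absolutely continuous functions from $\mathbb{R}$ to the unit sphere $S^2\subset\mathbb{R}^3$ (with the Euclidean metric of $\mathbb{R}^3$). $\widehat{\mathbb{C}}=\mathbb{C}\cup\{\infty\}$ is the Riemann sphere, and stereographic projection $\mathcal{S}:\widehat{\mathbb{C}}\to S^2$ is $\mathcal{S}(z)=\frac{1}{|z|^2+1}\bigl(2\,\mathrm{Re}\,z,\,2\,\mathrm{Im}\,z,\,|z|^2-1\bigr)$ for $z\in\mathbb{C}$, $\mathcal{S}(\infty)=(0,0,1)$. The statement that $q=\alpha^2+\alpha'$ holds almost everywhere includes that, at almost every $x$, $\alpha(x)$ is finite and $\alpha$ is differentiable at $x$. In the subscripts, $1$ denotes the constant function $1$. For $u,v\in L^1_{\mathrm{loc}}(\mathbb{R})$ and $j\ge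 1$ let $T^{(j)}_{u,v}(s_1,\ldots,s_j)=u(s_1)v(s_2)u(s_3)\cdots$ ($j$ factors, alternating $u$ with $v$, beginning with $u$). Set $A_0(u,v,x)=1$ and, for $j\geq 1$, $$A_j(u,v,x)=\int_{0<s_1<\cdots<s_j<x}T^{(j)}_{u,v}(s_1,\ldots,s_j)\,ds_1\cdots ds_j\quad (x\ge 0),$$ $$A_j(u,v,x)=(-1)^j\int_{x<s_j<\cdots<s_1<0}T^{(j)}_{u,v}(s_1,\ldots,s_j)\,ds_1\cdots ds_j\quad (x\le 0).$$ The bivariate exponential is $E_{u,v}(x)=1+\sum_{j=1}^\infty A_j(u,v,x)$ for $x\in\mathbb{R}$, and $$C_{u,v}=\tfrac12\bigl(E_{u,v}+E_{-u,-v}\bigr),\qquad S_{u,v}=\tfrac12\bigl(E_{u,v}-E_{-u,-v}\bigr).$$ *)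

theory Defs
  imports "HOL-Analysis.Analysis"
begin

definition locally_integrable :: "(real \<Rightarrow> complex) \<Rightarrow> bool" where
  "locally_integrable f \<longleftrightarrow> (\<forall>K. compact K \<longrightarrow> f absolutely_integrable_on K)"

definition absolutely_continuous_on_interval ::
    "real \<Rightarrow> real \<Rightarrow> (real \<Rightarrow> 'a::metric_space) \<Rightarrow> bool" where
  "absolutely_continuous_on_interval a b f \<longleftrightarrow>
     (\<forall>\<epsilon>>0. \<exists>\<delta>>0. \<forall>(n::nat) l r.
        (\<forall>i<n. a \<le> l i \<and> l i \<le> r i \<and> r i \<le> b) \<longrightarrow>
        disjoint_family_on (\<lambda>i. {l i<..<r i}) {..<n} \<longrightarrow>
        (\<Sum>i<n. r i - l i) < \<delta> \<longrightarrow>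
        (\<Sum>i<n. dist (f (l i)) (f (r i))) < \<epsilon>)"

definition AC_loc :: "'a::metric_space set \<Rightarrow> (real \<Rightarrow> 'a) set" where
  "AC_loc S = {f. range f \<subseteq> S \<and> (\<forall>a b. absolutely_continuous_on_interval a b f)}"

(* As for Alexandroff_compactification in the library, the point at infinity is None. *)
type_synonym riemann_sphere = "complex option"

definition extended_reals :: "riemann_sphere set" where
  "extended_reals = insert None (range (\<lambda>r. Some (complex_of_real r)))"

definition stereographic :: "riemann_sphere \<Rightarrow> real ^ 3" where
  "stereographic p =
     (case p of
        None \<Rightarrow> vector [0, 0, 1]
      | Some z \<Rightarrow> (1 / ((cmod z)\<^sup>2 + 1)) *\<^sub>R vector [2 * Re z, 2 * Im z, (cmod z)\<^sup>2 - 1])"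

(* Differentiability of a sphere-valued function at a point where it is finite: it has to be
   finite in a neighbourhood for the difference quotients to make sense, so that the value of
   "the" at None plays no role. *)
definition has_derivative_on_sphere ::
    "(real \<Rightarrow> riemann_sphere) \<Rightarrow> complex \<Rightarrow> real \<Rightarrow> bool" where
  "has_derivative_on_sphere \<alpha> d x \<longleftrightarrow>
     (\<forall>\<^sub>F t in nhds x. \<alpha> t \<noteq> None) \<and>
     ((\<lambda>t. the (\<alpha> t)) has_vector_derivative d) (at x)"

definition alternating_product ::
    "nat \<Rightarrow> (real \<Rightarrow> complex) \<Rightarrow> (real \<Rightarrow> complex) \<Rightarrow> (nat \<Rightarrow> real) \<Rightarrow> complex" where
  "alternating_product j u v s = (\<Prod>i=1..j. if odd i then u (s i) else v (s i))"

(* R^j is the product of j copies of the Lebesgue measure, with coordinates s 1, ..., s j. *)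
definition biv_A :: "nat \<Rightarrow> (real \<Rightarrow> complex) \<Rightarrow> (real \<Rightarrow> complex) \<Rightarrow> real \<Rightarrow> complex" where
  "biv_A j u v x =
     (if j = 0 then 1
      else if 0 \<le> x then
        set_lebesgue_integral (\<Pi>\<^sub>M i\<in>{1..j}. lebesgue)
          {s. strict_mono_on {1..j} s \<and> (\<forall>i\<in>{1..j}. 0 < s i \<and> s i < x)}
          (alternating_product j u v)
      else
        (-1) ^ j *
        set_lebesgue_integral (\<Pi>\<^sub>M i\<in>{1..j}. lebesgue)
          {s. strict_antimono_on {1..j} s \<and> (\<forall>i\<in>{1..j}. x < s i \<and> s i < 0)}
          (alternating_product j u v))"

definition biv_exp :: "(real \<Rightarrow> complex) \<Rightarrow> (real \<Rightarrow> complex) \<Rightarrow> real \<Rightarrow> complex" where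
  "biv_exp u v x = 1 + (\<Sum>j. biv_A (Suc j) u v x)"

definition biv_C :: "(real \<Rightarrow> complex) \<Rightarrow> (real \<Rightarrow> complex) \<Rightarrow> real \<Rightarrow> complex" where
  "biv_C u v x = (biv_exp u v x + biv_exp (\<lambda>t. - u t) (\<lambda>t. - v t) x) / 2"

definition biv_S :: "(real \<Rightarrow> complex) \<Rightarrow> (real \<Rightarrow> complex) \<Rightarrow> real \<Rightarrow> complex" where
  "biv_S u v x = (biv_exp u v x - biv_exp (\<lambda>t. - u t) (\<lambda>t. - v t) x) / 2"

definition miura_solution :: "(real \<Rightarrow> complex) \<Rightarrow> real \<Rightarrow> (real \<Rightarrow> riemann_sphere) \<Rightarrow> bool" where
  "miura_solution q y0 \<alpha> \<longleftrightarrow>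
     range \<alpha> \<subseteq> extended_reals \<and>
     \<alpha> 0 = Some (complex_of_real y0) \<and>
     (\<lambda>x. stereographic (\<alpha> x)) \<in> AC_loc (sphere 0 1) \<and>
     (AE x in lebesgue. \<exists>w d. \<alpha> x = Some w \<and> has_derivative_on_sphere \<alpha> d x \<and> q x = w\<^sup>2 + d)"

definition miura_inverse :: "(real \<Rightarrow> complex) \<Rightarrow> real \<Rightarrow> real \<Rightarrow> riemann_sphere" where
  "miura_inverse q y0 x =
     (let num = complex_of_real y0 * biv_C (\<lambda>_. 1) q x + biv_S q (\<lambda>_. 1) x;
          den = complex_of_real y0 * biv_S (\<lambda>_. 1) q x + biv_C q (\<lambda>_. 1) x
      in if den = 0 then None else Some (num / den))"

end

theory Submission
  imports Defs
begin

text \<open>The \<open>j\<close>-fold integral \<open>A\<^sub>j\<close> is the primitive of \<open>A\<^bsub>j-1\<^esub>\<close> times \<open>u\<close> or \<open>v\<close>. Summing over the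
  parity of \<open>j\<close> shows that the numerator \<open>n\<close> and the denominator \<open>d\<close> of the asserted solution satisfy
  \<open>n' = q d\<close> and \<open>d' = n\<close> with \<open>n(0) = y\<^sub>0\<close> and \<open>d(0) = 1\<close>, so \<open>n / d\<close> solves \<open>q = \<alpha>\<^sup>2 + \<alpha>'\<close>. By Gronwall
  applied to \<open>n\<^sup>2 + d\<^sup>2\<close>, the two never vanish together. For uniqueness, the function
  \<open>(\<alpha> d - n)\<^sup>2 / (\<alpha>\<^sup>2 + 1)\<close> extends over the poles of \<open>\<alpha>\<close> to an absolutely continuous function \<open>F\<close> with
  \<open>F(0) = 0\<close> and \<open>\<bar>F'\<bar> \<le> (1 + \<bar>q\<bar>) F\<close>, so it is zero by Gronwall.\<close>

section \<open>Absolutely continuous functions\<close>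

text \<open>The linear system is the classical linearization: \<open>\<alpha> = d' / d\<close> turns
  \<open>q = \<alpha>^2 + \<alpha>'\<close> into \<open>d'' = q d\<close>, and
  \<open>n = d'\<close>. As \<open>q\<close> is only locally integrable, \<open>n\<close> is merely
  absolutely continuous and its derivative is known only almost everywhere. Both Gronwall arguments
  therefore rest on one fact: an absolutely continuous function whose derivative is nonpositive
  almost everywhere is nonincreasing. It is applied after multiplication by an integrating factor.
  The obstacle to uniqueness is the set of poles of \<alpha>, which is a priori only known to be
  null. The natural quantity \<open>e = \<alpha> d - n\<close> satisfies
  \<open>e' = - \<alpha> e\<close>, with a rate that is unbounded near a pole. Division of
  \<open>e^2\<close> by \<open>\<alpha>^2 + 1\<close> repairs this: the rate becomes
  \<open>- 2 \<alpha> (1 + q) / (\<alpha>^2 + 1)\<close>, and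
  \<open>2 |\<alpha>| <= \<alpha>^2 + 1\<close>. Moreover, the quotient is a polynomial in
  \<open>n\<close>, \<open>d\<close> and the coordinates of the stereographic image, so it inherits
  absolute continuity across the poles.\<close>

lemma absolutely_continuous_on_intervalD:
  fixes f :: "real \<Rightarrow> 'a::metric_space"
  assumes "absolutely_continuous_on_interval a b f" "\<epsilon> > 0"
  shows "\<exists>\<delta>>0. \<forall>(I::'i set) l r. finite I \<longrightarrow> (\<forall>i\<in>I. a \<le> l i \<and> l i \<le> r i \<and> r i \<le> b) \<longrightarrow>
       disjoint_family_on (\<lambda>i. {l i<..<r i}) I \<longrightarrow> (\<Sum>i\<in>I. r i - l i) < \<delta> \<longrightarrow>
       (\<Sum>i\<in>I. dist (f (l i)) (f (r i))) < \<epsilon>"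
proof -
  obtain \<delta> where \<delta>: "\<delta> > 0" and ac: "\<And>(n::nat) l r.
        (\<forall>i<n. a \<le> l i \<and> l i \<le> r i \<and> r i \<le> b) \<Longrightarrow>
        disjoint_family_on (\<lambda>i. {l i<..<r i}) {..<n} \<Longrightarrow>
        (\<Sum>i<n. r i - l i) < \<delta> \<Longrightarrow>
        (\<Sum>i<n. dist (f (l i)) (f (r i))) < \<epsilon>"
    using assms unfolding absolutely_continuous_on_interval_def by meson
  show ?thesis
  proof (intro exI conjI allI impI, rule \<delta>)
    fix I :: "'i set" and l r
    assume fin: "finite I" and lr: "\<forall>i\<in>I. a \<le> l i \<and> l i \<le> r i \<and> r i \<le> b"
      and dis: "disjoint_family_on (\<lambda>i. {l i<..<r i}) I" and len: "(\<Sum>i\<in>I. r i - l i) < \<delta>"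
    \<comment> \<open>Transporting to an initial segment of the naturals allows any finite index
      set, such as a set of tagged intervals or a single point.\<close>
    obtain h where h: "bij_betw h {..<card I} I"
      using ex_bij_betw_nat_finite[OF fin] by (auto simp: atLeast0LessThan)
    have hI: "\<And>k. k < card I \<Longrightarrow> h k \<in> I" using h by (auto simp: bij_betw_def)
    have "(\<Sum>k<card I. dist (f (l (h k))) (f (r (h k)))) < \<epsilon>"
    proof (rule ac)
      show "\<forall>k<card I. a \<le> l (h k) \<and> l (h k) \<le> r (h k) \<and> r (h k) \<le> b" using lr hI by blast
      show "disjoint_family_on (\<lambda>k. {l (h k)<..<r (h k)}) {..<card I}"
        unfolding disjoint_family_on_def
      proof (intro ballI impI)
        fix m n assume "m \<in> {..<card I}" "n \<in> {..<card I}" "m \<noteq> n"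
        then have "h m \<in> I" "h n \<in> I" "h m \<noteq> h n"
          using h by (auto simp: bij_betw_def inj_on_def)
        then show "{l (h m)<..<r (h m)} \<inter> {l (h n)<..<r (h n)} = {}"
          using dis unfolding disjoint_family_on_def by blast
      qed
      show "(\<Sum>k<card I. r (h k) - l (h k)) < \<delta>"
        using len sum.reindex_bij_betw[OF h, of "\<lambda>i. r i - l i"] by simp
    qed
    then show "(\<Sum>i\<in>I. dist (f (l i)) (f (r i))) < \<epsilon>"
      using sum.reindex_bij_betw[OF h, of "\<lambda>i. dist (f (l i)) (f (r i))"] by simp
  qed
qed

text \<open>The one principle behind the closure properties of \<open>AC_loc\<close>. The Lipschitz
  constant may depend on the interval, since products, exponentials and reciprocals are only locally
  Lipschitz. A constant \<open>g\<close> gives the version for one function.\<close>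

lemma AC_locI_Lipschitz2:
  fixes f :: "real \<Rightarrow> 'a::metric_space" and g :: "real \<Rightarrow> 'b::metric_space"
    and h :: "real \<Rightarrow> 'c::metric_space"
  assumes f: "f \<in> AC_loc S" and g: "g \<in> AC_loc T" and ran: "range h \<subseteq> U"
    and lip: "\<And>a b. \<exists>K. \<forall>x\<in>{a..b}. \<forall>y\<in>{a..b}. dist (h x) (h y) \<le> K * (dist (f x) (f y) + dist (g x) (g y))"
  shows "h \<in> AC_loc U"
  unfolding AC_loc_def absolutely_continuous_on_interval_def
proof (intro CollectI conjI allI impI ran)
  fix a b \<epsilon> :: real assume \<epsilon>: "\<epsilon> > 0"
  obtain K0 where K0: "\<And>x y. x \<in> {a..b} \<Longrightarrow> y \<in> {a..b} \<Longrightarrow> dist (h x) (h y) \<le> K0 * (dist (f x) (f y) + dist (g x) (g y))"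
    using lip[of a b] by blast
  define K where "K = \<bar>K0\<bar> + 1"
  have K: "K > 0" by (simp add: K_def)
  have lipK: "dist (h x) (h y) \<le> K * (dist (f x) (f y) + dist (g x) (g y))"
    if "x \<in> {a..b}" "y \<in> {a..b}" for x y
    by (rule order_trans[OF K0[OF that] mult_right_mono]) (auto simp: K_def)
  have e: "\<epsilon> / (2 * K) > 0" using \<epsilon> K by simp
  obtain \<delta>1 where \<delta>1: "\<delta>1 > 0" "\<And>(n::nat) l r. (\<forall>i<n. a \<le> l i \<and> l i \<le> r i \<and> r i \<le> b) \<Longrightarrow>
        disjoint_family_on (\<lambda>i. {l i<..<r i}) {..<n} \<Longrightarrow> (\<Sum>i<n. r i - l i) < \<delta>1 \<Longrightarrow>
        (\<Sum>i<n. dist (f (l i)) (f (r i))) < \<epsilon> / (2 * K)"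
    using f e unfolding AC_loc_def absolutely_continuous_on_interval_def by blast
  obtain \<delta>2 where \<delta>2: "\<delta>2 > 0" "\<And>(n::nat) l r. (\<forall>i<n. a \<le> l i \<and> l i \<le> r i \<and> r i \<le> b) \<Longrightarrow>
        disjoint_family_on (\<lambda>i. {l i<..<r i}) {..<n} \<Longrightarrow> (\<Sum>i<n. r i - l i) < \<delta>2 \<Longrightarrow>
        (\<Sum>i<n. dist (g (l i)) (g (r i))) < \<epsilon> / (2 * K)"
    using g e unfolding AC_loc_def absolutely_continuous_on_interval_def by blast
  show "\<exists>\<delta>>0. \<forall>(n::nat) l r. (\<forall>i<n. a \<le> l i \<and> l i \<le> r i \<and> r i \<le> b) \<longrightarrow>
        disjoint_family_on (\<lambda>i. {l i<..<r i}) {..<n} \<longrightarrow> (\<Sum>i<n. r i - l i) < \<delta> \<longrightarrow>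
        (\<Sum>i<n. dist (h (l i)) (h (r i))) < \<epsilon>"
  proof (intro exI[of _ "min \<delta>1 \<delta>2"] conjI allI impI)
    show "min \<delta>1 \<delta>2 > 0" using \<delta>1 \<delta>2 by simp
    fix n :: nat and l r
    assume lr: "\<forall>i<n. a \<le> l i \<and> l i \<le> r i \<and> r i \<le> b"
      and dis: "disjoint_family_on (\<lambda>i. {l i<..<r i}) {..<n}"
      and len: "(\<Sum>i<n. r i - l i) < min \<delta>1 \<delta>2"
    have 1: "(\<Sum>i<n. dist (f (l i)) (f (r i))) < \<epsilon> / (2 * K)" using \<delta>1(2)[OF lr dis] len by simp
    have 2: "(\<Sum>i<n. dist (g (l i)) (g (r i))) < \<epsilon> / (2 * K)" using \<delta>2(2)[OF lr dis] len by simp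
    have "(\<Sum>i<n. dist (h (l i)) (h (r i))) \<le> (\<Sum>i<n. K * (dist (f (l i)) (f (r i)) + dist (g (l i)) (g (r i))))"
    proof (rule sum_mono)
      fix i assume "i \<in> {..<n}"
      then have "l i \<in> {a..b}" "r i \<in> {a..b}" using lr by (auto intro: order_trans)
      then show "dist (h (l i)) (h (r i)) \<le> K * (dist (f (l i)) (f (r i)) + dist (g (l i)) (g (r i)))"
        by (rule lipK)
    qed
    also have "\<dots> = K * ((\<Sum>i<n. dist (f (l i)) (f (r i))) + (\<Sum>i<n. dist (g (l i)) (g (r i))))"
      by (simp add: sum_distrib_left sum.distrib distrib_left)
    also have "\<dots> < K * (\<epsilon> / (2 * K) + \<epsilon> / (2 * K))"
      using 1 2 K by (intro mult_strict_left_mono add_strict_mono)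
    also have "\<dots> = \<epsilon>" using K by (simp add: field_simps)
    finally show "(\<Sum>i<n. dist (h (l i)) (h (r i))) < \<epsilon>" .
  qed
qed

lemma AC_loc_continuous_on:
  assumes "f \<in> AC_loc S"
  shows "continuous_on A f"
proof -
  have "isCont f x" for x
    unfolding continuous_at_eps_delta
  proof (intro allI impI)
    fix \<epsilon> :: real assume \<epsilon>: "\<epsilon> > 0"
    have ac: "absolutely_continuous_on_interval (x - 1) (x + 1) f"
      using assms by (auto simp: AC_loc_def)
    obtain \<delta> where \<delta>: "\<delta> > 0"
      "\<forall>(I::unit set) l r. finite I \<longrightarrow> (\<forall>i\<in>I. x - 1 \<le> l i \<and> l i \<le> r i \<and> r i \<le> x + 1) \<longrightarrow>
       disjoint_family_on (\<lambda>i. {l i<..<r i}) I \<longrightarrow> (\<Sum>i\<in>I. r i - l i) < \<delta> \<longrightarrow>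
       (\<Sum>i\<in>I. dist (f (l i)) (f (r i))) < \<epsilon>"
      using absolutely_continuous_on_intervalD[OF ac \<epsilon>, where 'i=unit] by blast
    have "dist (f y) (f x) < \<epsilon>" if "dist y x < min \<delta> 1" for y
    proof -
      have "dist (f (min x y)) (f (max x y)) < \<epsilon>"
        using \<delta>(2)[rule_format, of "{()}" "\<lambda>_. min x y" "\<lambda>_. max x y"] that
        by (auto simp: disjoint_family_on_def dist_real_def min_def max_def split: if_splits)
      then show ?thesis by (auto simp: min_def max_def dist_commute split: if_splits)
    qed
    then show "\<exists>d>0. \<forall>x'. dist x' x < d \<longrightarrow> dist (f x') (f x) < \<epsilon>"
      using \<delta>(1) by (intro exI[of _ "min \<delta> 1"]) auto
  qed
  then show ?thesis by (simp add: continuous_at_imp_continuous_on)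
qed

lemma AC_loc_bounded:
  fixes f :: "real \<Rightarrow> 'a::real_normed_vector"
  assumes "f \<in> AC_loc S"
  obtains B where "B > 0" "\<And>x. x \<in> {a..b} \<Longrightarrow> norm (f x) \<le> B"
proof -
  have "bounded (f ` {a..b})"
    by (intro compact_imp_bounded compact_continuous_image AC_loc_continuous_on[OF assms]) simp
  then show thesis using that bounded_pos by (metis imageI)
qed

section \<open>Closure properties of local absolute continuity\<close>

lemma AC_loc_const: "(\<lambda>x. c) \<in> AC_loc UNIV"
  by (auto simp: AC_loc_def absolutely_continuous_on_interval_def intro: exI[of _ 1])

lemma AC_loc_add:
  fixes f g :: "real \<Rightarrow> 'a::real_normed_vector"
  assumes "f \<in> AC_loc UNIV" "g \<in> AC_loc UNIV"
  shows "(\<lambda>x. f x + g x) \<in> AC_loc UNIV"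
  by (rule AC_locI_Lipschitz2[OF assms])
     (auto intro!: exI[of _ 1] simp: dist_triangle_add)

lemma AC_loc_mult:
  fixes f g :: "real \<Rightarrow> real"
  assumes f: "f \<in> AC_loc UNIV" and g: "g \<in> AC_loc UNIV"
  shows "(\<lambda>x. f x * g x) \<in> AC_loc UNIV"
proof (rule AC_locI_Lipschitz2[OF f g])
  fix a b
  obtain B where B: "B > 0" "\<And>x. x \<in> {a..b} \<Longrightarrow> norm (f x) \<le> B" by (rule AC_loc_bounded[OF f]) blast
  obtain C where C: "C > 0" "\<And>x. x \<in> {a..b} \<Longrightarrow> norm (g x) \<le> C" by (rule AC_loc_bounded[OF g]) blast
  show "\<exists>K. \<forall>x\<in>{a..b}. \<forall>y\<in>{a..b}. dist (f x * g x) (f y * g y) \<le> K * (dist (f x) (f y) + dist (g x) (g y))"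
  proof (intro exI[of _ "B + C"] ballI)
    fix x y assume xy: "x \<in> {a..b}" "y \<in> {a..b}"
    have "f x * g x - f y * g y = f x * (g x - g y) + (f x - f y) * g y" by (simp add: algebra_simps)
    then have "dist (f x * g x) (f y * g y) \<le> \<bar>f x\<bar> * dist (g x) (g y) + dist (f x) (f y) * \<bar>g y\<bar>"
      unfolding dist_real_def by (metis abs_mult abs_triangle_ineq)
    also have "\<dots> \<le> B * dist (g x) (g y) + dist (f x) (f y) * C"
      using B(2)[OF xy(1)] C(2)[OF xy(2)] by (intro add_mono mult_mono) (auto simp: B(1) less_imp_le)
    also have "\<dots> \<le> (B + C) * (dist (f x) (f y) + dist (g x) (g y))"
      using B(1) C(1) by (simp add: algebra_simps)
    finally show "dist (f x * g x) (f y * g y) \<le> (B + C) * (dist (f x) (f y) + dist (g x) (g y))" .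
  qed
qed simp

lemma AC_loc_cmult:
  fixes f :: "real \<Rightarrow> real"
  assumes "f \<in> AC_loc UNIV"
  shows "(\<lambda>x. c * f x) \<in> AC_loc UNIV"
  by (rule AC_loc_mult[OF AC_loc_const assms])

lemma AC_loc_power:
  fixes f :: "real \<Rightarrow> real"
  assumes "f \<in> AC_loc UNIV"
  shows "(\<lambda>x. f x ^ n) \<in> AC_loc UNIV"
  by (induction n) (auto intro: AC_loc_const AC_loc_mult assms)

lemma AC_loc_exp:
  fixes f :: "real \<Rightarrow> real"
  assumes f: "f \<in> AC_loc UNIV"
  shows "(\<lambda>x. exp (f x)) \<in> AC_loc UNIV"
proof (rule AC_locI_Lipschitz2[OF f AC_loc_const[of "0::real"]])
  fix a b
  obtain B where B: "B > 0" "\<And>x. x \<in> {a..b} \<Longrightarrow> norm (f x) \<le> B" by (rule AC_loc_bounded[OF f]) blast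
  \<comment> \<open>The tangent line bound \<open>1 + h <= exp h\<close> at
    \<open>h = v - u\<close>, used below in both orders, yields the local Lipschitz
    estimate.\<close>
  have *: "exp u - exp v \<le> exp B * \<bar>u - v\<bar>" if "\<bar>u\<bar> \<le> B" for u v :: real
  proof -
    have "exp u * (1 + (v - u)) \<le> exp u * exp (v - u)" by (intro mult_left_mono exp_ge_add_one_self) auto
    also have "\<dots> = exp v" by (simp add: exp_add[symmetric])
    finally have "exp u - exp v \<le> exp u * (u - v)" by (simp add: algebra_simps)
    also have "\<dots> \<le> exp u * \<bar>u - v\<bar>" by simp
    also have "\<dots> \<le> exp B * \<bar>u - v\<bar>" using that by (simp add: mult_right_mono)
    finally show ?thesis .
  qed
  have "dist (exp (f x)) (exp (f y)) \<le> exp B * dist (f x) (f y)" if "x \<in> {a..b}" "y \<in> {a..b}" for x y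
    using *[of "f x" "f y"] *[of "f y" "f x"] B(2)[OF that(1)] B(2)[OF that(2)] abs_minus_commute[of "f x" "f y"]
    unfolding dist_real_def by (intro abs_leI) simp_all
  then show "\<exists>K. \<forall>x\<in>{a..b}. \<forall>y\<in>{a..b}. dist (exp (f x)) (exp (f y)) \<le> K * (dist (f x) (f y) + dist (0::real) 0)"
    by (intro exI[of _ "exp B"]) auto
qed simp

text \<open>Cousin's lemma: the gauge sends tags outside the exceptional null set to neighbourhoods on
  which the difference quotient is nearly nonpositive, and the remaining tags into a small open set,
  where absolute continuity bounds the total increment.\<close>
lemma AC_loc_nonincreasing:
  fixes F :: "real \<Rightarrow> real"
  assumes F: "F \<in> AC_loc UNIV"
    and der: "AE x in lebesgue. \<exists>D\<le>0. (F has_real_derivative D) (at x)"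
    and ab: "a \<le> b"
  shows "F b \<le> F a"
proof -
  obtain N where N: "N \<in> null_sets lebesgue"
    and N': "\<And>x. x \<notin> N \<Longrightarrow> \<exists>D\<le>0. (F has_real_derivative D) (at x)"
    by (rule AE_E3[OF der]) auto
  have "F b - F a \<le> \<epsilon> * (b - a) + \<epsilon>" if \<epsilon>: "\<epsilon> > 0" for \<epsilon>
  proof -
    have acF: "absolutely_continuous_on_interval a b F" using F by (auto simp: AC_loc_def)
    obtain \<delta> where \<delta>: "\<delta> > 0" and ac:
      "\<forall>(I::(real \<times> real set) set) l r. finite I \<longrightarrow> (\<forall>i\<in>I. a \<le> l i \<and> l i \<le> r i \<and> r i \<le> b) \<longrightarrow>
       disjoint_family_on (\<lambda>i. {l i<..<r i}) I \<longrightarrow> (\<Sum>i\<in>I. r i - l i) < \<delta> \<longrightarrow>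
       (\<Sum>i\<in>I. dist (F (l i)) (F (r i))) < \<epsilon>"
      using absolutely_continuous_on_intervalD[OF acF \<epsilon>, where 'i="real \<times> real set"] by blast
    obtain U where U: "open U" "N \<subseteq> U" "emeasure lebesgue (U - N) < ennreal \<delta>"
      using sets_lebesgue_outer_open[OF null_setsD2[OF N] \<delta>] by metis
    have Us: "U \<in> sets lebesgue" using U(1) lebesgue_openin[of UNIV U] by (simp add: lborelD)
    have emU: "emeasure lebesgue U < ennreal \<delta>"
      using U(3) emeasure_Diff_null_set[OF N Us] by (simp only:)
    \<comment> \<open>The increments to the left and to the right of \<open>x\<close> are bounded
      separately, so that the two bounds add up over an interval whose tag lies between its
      endpoints.\<close>
    define Q where "Q x \<eta> \<longleftrightarrow> \<eta> > 0 \<and> (\<forall>y. \<bar>y - x\<bar> < \<eta> \<longrightarrow>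
      (y \<ge> x \<longrightarrow> F y - F x \<le> \<epsilon> * (y - x)) \<and> (y \<le> x \<longrightarrow> F x - F y \<le> \<epsilon> * (x - y)))" for x \<eta>
    have "\<exists>\<eta>. Q x \<eta>" if xN: "x \<notin> N" for x
    proof -
      obtain D where D: "D \<le> 0" "(F has_real_derivative D) (at x)" using N'[OF xN] by blast
      then obtain \<eta> where \<eta>: "\<eta> > 0" "\<And>y. \<bar>y - x\<bar> < \<eta> \<Longrightarrow> \<bar>F y - F x - D * (y - x)\<bar> \<le> \<epsilon> * \<bar>y - x\<bar>"
        using \<epsilon> unfolding has_field_derivative_def has_derivative_at_alt real_norm_def by blast
      show ?thesis unfolding Q_def
      proof (intro exI[of _ \<eta>] conjI allI impI \<eta>(1))
        fix y assume "\<bar>y - x\<bar> < \<eta>" "y \<ge> x"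
        then show "F y - F x \<le> \<epsilon> * (y - x)"
          using \<eta>(2)[of y] mult_nonpos_nonneg[OF D(1), of "y - x"] by (simp add: abs_le_iff)
      next
        fix y assume "\<bar>y - x\<bar> < \<eta>" "y \<le> x"
        then show "F x - F y \<le> \<epsilon> * (x - y)"
          using \<eta>(2)[of y] mult_nonpos_nonneg[OF D(1), of "x - y"] by (simp add: abs_le_iff algebra_simps)
      qed
    qed
    then obtain \<eta> where "\<forall>x\<in>-N. Q x (\<eta> x)" using bchoice[of "-N" Q] by auto
    then have \<eta>: "\<And>x. x \<notin> N \<Longrightarrow> \<eta> x > 0"
      "\<And>x y. x \<notin> N \<Longrightarrow> \<bar>y - x\<bar> < \<eta> x \<Longrightarrow> y \<ge> x \<Longrightarrow> F y - F x \<le> \<epsilon> * (y - x)"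
      "\<And>x y. x \<notin> N \<Longrightarrow> \<bar>y - x\<bar> < \<eta> x \<Longrightarrow> y \<le> x \<Longrightarrow> F x - F y \<le> \<epsilon> * (x - y)"
      by (auto simp: Q_def)
    define \<gamma> where "\<gamma> x = (if x \<in> N then U else ball x (\<eta> x))" for x
    have "gauge \<gamma>" using U \<eta>(1) by (auto simp: gauge_def \<gamma>_def)
    then obtain p where p: "p tagged_division_of {a..b}" and fine: "\<gamma> fine p"
      by (rule fine_division_exists_real)
    have fp: "finite p" using p by blast
    have pK: "snd t = {Inf (snd t)..Sup (snd t)} \<and> Inf (snd t) \<le> Sup (snd t) \<and> a \<le> Inf (snd t) \<and>
      Sup (snd t) \<le> b \<and> Inf (snd t) \<le> fst t \<and> fst t \<le> Sup (snd t)"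
      if tp: "t \<in> p" for t
    proof -
      obtain x K where t: "t = (x, K)" by fastforce
      then have xK: "(x, K) \<in> p" using tp by simp
      obtain u v where uv: "K = {u..v}" using tagged_division_ofD(4)[OF p xK] by (auto simp: box_real)
      have "x \<in> K" "K \<subseteq> {a..b}" using tagged_division_ofD(2,3)[OF p xK] by auto
      then show ?thesis using uv t by auto
    qed
    define A where "A = {t \<in> p. fst t \<in> N}"
    have Ap: "A \<subseteq> p" "finite A" using fp by (auto simp: A_def)
    have sumA: "(\<Sum>t\<in>A. dist (F (Inf (snd t))) (F (Sup (snd t)))) < \<epsilon>"
    proof (rule ac[rule_format, OF Ap(2)])
      fix t assume "t \<in> A"
      then show "a \<le> Inf (snd t) \<and> Inf (snd t) \<le> Sup (snd t) \<and> Sup (snd t) \<le> b"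
        using pK[of t] Ap(1) by blast
    next
      have int: "{Inf (snd t)<..<Sup (snd t)} = interior (snd t)" if "t \<in> A" for t
        using pK[of t] Ap(1) that by (metis interior_atLeastAtMost_real subsetD)
      show dis: "disjoint_family_on (\<lambda>t. {Inf (snd t)<..<Sup (snd t)}) A"
        unfolding disjoint_family_on_def
      proof (intro ballI impI)
        fix s t assume st: "s \<in> A" "t \<in> A" "s \<noteq> t"
        then have "interior (snd s) \<inter> interior (snd t) = {}"
          using tagged_division_ofD(5)[OF p, of "fst s" "snd s" "fst t" "snd t"] Ap(1)
          by (metis prod.collapse subsetD)
        then show "{Inf (snd s)<..<Sup (snd s)} \<inter> {Inf (snd t)<..<Sup (snd t)} = {}"
          using int st by simp
      qed
      have sub: "(\<Union>t\<in>A. {Inf (snd t)<..<Sup (snd t)}) \<subseteq> U"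
      proof
        fix y assume "y \<in> (\<Union>t\<in>A. {Inf (snd t)<..<Sup (snd t)})"
        then obtain t where t: "t \<in> A" "y \<in> interior (snd t)" using int by auto
        then have "snd t \<subseteq> \<gamma> (fst t)" "fst t \<in> N"
          using fine unfolding fine_def A_def by (auto simp: case_prod_beta)
        then show "y \<in> U" using t interior_subset by (auto simp: \<gamma>_def)
      qed
      have len: "Inf (snd t) \<le> Sup (snd t)" if "t \<in> A" for t
        using pK[of t] Ap(1) that by blast
      have "ennreal (\<Sum>t\<in>A. Sup (snd t) - Inf (snd t)) = (\<Sum>t\<in>A. ennreal (Sup (snd t) - Inf (snd t)))"
        using len by (subst sum_ennreal) auto
      also have "\<dots> = (\<Sum>t\<in>A. emeasure lebesgue {Inf (snd t)<..<Sup (snd t)})"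
        using len by (intro sum.cong refl) simp
      also have "\<dots> = emeasure lebesgue (\<Union>t\<in>A. {Inf (snd t)<..<Sup (snd t)})"
        using dis Ap(2) by (intro sum_emeasure) auto
      also have "\<dots> \<le> emeasure lebesgue U" using sub Us by (rule emeasure_mono)
      also have "\<dots> < ennreal \<delta>" by (rule emU)
      finally show "(\<Sum>t\<in>A. Sup (snd t) - Inf (snd t)) < \<delta>"
        using len by (subst (asm) ennreal_less_iff) (auto intro!: sum_nonneg)
    qed
    have "F b - F a = (\<Sum>(x,K)\<in>p. F (Sup K) - F (Inf K))"
      using additive_tagged_division_1[OF ab p, of F] by simp
    also have "\<dots> = (\<Sum>t\<in>p. F (Sup (snd t)) - F (Inf (snd t)))" by (simp add: case_prod_beta)
    also have "\<dots> = (\<Sum>t\<in>A. F (Sup (snd t)) - F (Inf (snd t))) + (\<Sum>t\<in>p-A. F (Sup (snd t)) - F (Inf (snd t)))"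
      using sum.subset_diff[OF Ap(1) fp] by (simp add: add.commute)
    also have "\<dots> \<le> (\<Sum>t\<in>A. dist (F (Inf (snd t))) (F (Sup (snd t)))) + (\<Sum>t\<in>p-A. \<epsilon> * measure lborel (snd t))"
    proof (intro add_mono sum_mono)
      fix t assume "t \<in> p - A"
      then obtain x K where t: "t = (x, K)" "(x, K) \<in> p" "x \<notin> N" by (cases t) (auto simp: A_def)
      obtain u v where uv: "K = {u..v}" "Inf K = u" "Sup K = v" "u \<le> x" "x \<le> v" using pK[OF t(2)] by auto
      have "K \<subseteq> ball x (\<eta> x)" using fine t unfolding fine_def \<gamma>_def by fastforce
      moreover have "u \<in> K" "v \<in> K" using uv by auto
      ultimately have "u \<in> ball x (\<eta> x)" "v \<in> ball x (\<eta> x)" by blast+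
      then have "\<bar>u - x\<bar> < \<eta> x" "\<bar>v - x\<bar> < \<eta> x" unfolding mem_ball dist_real_def by linarith+
      then have "F x - F u \<le> \<epsilon> * (x - u)" "F v - F x \<le> \<epsilon> * (v - x)" using \<eta>(2,3) t(3) uv by auto
      then have "F v - F u \<le> \<epsilon> * (v - u)" by (simp add: algebra_simps)
      then show "F (Sup (snd t)) - F (Inf (snd t)) \<le> \<epsilon> * measure lborel (snd t)" using t uv by simp
    qed (auto simp: dist_real_def)
    also have "(\<Sum>t\<in>p-A. \<epsilon> * measure lborel (snd t)) \<le> (\<Sum>t\<in>p. \<epsilon> * measure lborel (snd t))"
      using \<epsilon> fp by (intro sum_mono2) auto
    also have "\<dots> = \<epsilon> * (b - a)"
      using additive_content_tagged_division[of p a b] p ab by (simp add: sum_distrib_left[symmetric] case_prod_beta box_real)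
    finally show ?thesis using sumA by linarith
  qed
  then have le: "F b - F a \<le> \<epsilon> * (b - a + 1)" if "\<epsilon> > 0" for \<epsilon> using that by (simp add: algebra_simps)
  show ?thesis
  proof (rule ccontr)
    assume "\<not> F b \<le> F a"
    define c where "c = b - a + 1"
    have c: "c > 0" using ab by (simp add: c_def)
    \<comment> \<open>With this \<epsilon> the bound \<open>le\<close> becomes half of the
      increment, which is impossible for a positive increment.\<close>
    with \<open>\<not> F b \<le> F a\<close> have "(F b - F a) / (2 * c) > 0" by simp
    from le[OF this] have "F b - F a \<le> (F b - F a) / (2 * c) * c" by (simp only: c_def)
    then have "F b - F a \<le> (F b - F a) / 2" using c by simp
    with \<open>\<not> F b \<le> F a\<close> show False by simp
  qed
qed

section \<open>Primitives of locally integrable functions\<close>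

text \<open>Intervals suffice for primitives. The general codomain serves both the complex
  coefficients and the real functions obtained from them.\<close>

definition loc_int :: "(real \<Rightarrow> 'a::euclidean_space) \<Rightarrow> bool" where
  "loc_int f \<longleftrightarrow> (\<forall>a b. f absolutely_integrable_on {a..b})"

lemma loc_intD: "loc_int f \<Longrightarrow> f absolutely_integrable_on {a..b}"
  by (simp add: loc_int_def)

lemma loc_int_integrable: "loc_int f \<Longrightarrow> f integrable_on {a..b}"
  by (rule set_lebesgue_integral_eq_integral(1)[OF loc_intD])

lemma loc_int_const: "loc_int (\<lambda>x. c)"
  by (auto simp: loc_int_def intro!: absolutely_integrable_continuous_real)

lemma loc_int_add: "loc_int f \<Longrightarrow> loc_int g \<Longrightarrow> loc_int (\<lambda>x. f x + g x)"
  unfolding loc_int_def by (intro allI set_integral_add(1)) auto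

lemma loc_int_norm: "loc_int f \<Longrightarrow> loc_int (\<lambda>x. norm (f x))"
  unfolding loc_int_def using absolutely_integrable_norm by (force simp: o_def)

lemma loc_int_linear: "loc_int f \<Longrightarrow> bounded_linear h \<Longrightarrow> loc_int (\<lambda>x. h (f x))"
  unfolding loc_int_def using absolutely_integrable_linear by (force simp: o_def)

lemma loc_int_mult_continuous:
  fixes f g :: "real \<Rightarrow> 'a::{euclidean_space, real_normed_algebra}"
  assumes f: "loc_int f" and g: "continuous_on UNIV g"
  shows "loc_int (\<lambda>x. f x * g x)"
  unfolding loc_int_def
proof (intro allI)
  fix a b :: real
  have c: "continuous_on {a..b} g" using g continuous_on_subset by blast
  show "(\<lambda>x. f x * g x) absolutely_integrable_on {a..b}"
  \<comment> \<open>The rule expects the bounded factor first; the swapped product restores the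
    order, as multiplication need not commute here.\<close>
  proof (rule absolutely_integrable_bounded_measurable_product[where h="\<lambda>x y. y * x" and f=g and g=f])
    have "bilinear (\<lambda>x y::'a. x * y)" by (rule bilinear_times)
    then show "bilinear (\<lambda>x y::'a. y * x)" unfolding bilinear_def by blast
    show "g \<in> borel_measurable (lebesgue_on {a..b})"
      using c by (intro continuous_imp_measurable_on_sets_lebesgue) auto
    show "bounded (g ` {a..b})"
      using c by (intro compact_imp_bounded compact_continuous_image) auto
  qed (auto intro: loc_intD[OF f])
qed

text \<open>Oriented from 0: the sign to the left of 0 absorbs the factors \<open>(-1) ^ j\<close>
  of \<open>biv_A\<close>, so that one recursion holds on both half-lines.\<close>

definition prim :: "(real \<Rightarrow> 'a::euclidean_space) \<Rightarrow> real \<Rightarrow> 'a" where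
  "prim f x = (if 0 \<le> x then integral {0..x} f else - integral {x..0} f)"

lemma prim_0 [simp]: "prim f 0 = 0"
  by (simp add: prim_def)

lemma prim_diff:
  assumes f: "loc_int f" and "a \<le> b"
  shows "prim f b - prim f a = integral {a..b} f"
proof -
  note comb = Henstock_Kurzweil_Integration.integral_combine[OF _ _ loc_int_integrable[OF f]]
  consider "0 \<le> a" | "a < 0" "0 \<le> b" | "b < 0" using \<open>a \<le> b\<close> by linarith
  then show ?thesis
  proof cases
    case 1 then show ?thesis using comb[of 0 a b] \<open>a \<le> b\<close> by (simp add: prim_def algebra_simps)
  next
    case 2 then show ?thesis using comb[of a 0 b] by (simp add: prim_def add.commute)
  next
    case 3 then show ?thesis using comb[of a b 0] \<open>a \<le> b\<close> by (simp add: prim_def algebra_simps)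
  qed
qed

text \<open>Endpoints do not affect the integrals, and at every point at most one of the
  restrictions of \<open>k\<close> to the open intervals is nonzero, so their sum is at most
  \<open>k\<close>.\<close>

lemma sum_integral_disjoint_le:
  fixes k :: "real \<Rightarrow> real" and n :: nat
  assumes k: "k integrable_on {a..b}" and pos: "\<And>x. 0 \<le> k x"
    and lr: "\<And>i. i < n \<Longrightarrow> a \<le> l i \<and> l i \<le> r i \<and> r i \<le> b"
    and dis: "disjoint_family_on (\<lambda>i. {l i<..<r i}) {..<n}"
  shows "(\<Sum>i<n. integral {l i..r i} k) \<le> integral {a..b} k"
proof -
  define g where "g i x = (if x \<in> {l i<..<r i} then k x else 0)" for i x
  have g: "(g i has_integral integral {l i..r i} k) {a..b}" if i: "i < n" for i
  proof -
    have "k integrable_on {l i..r i}"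
      using k lr[OF i] by (intro integrable_subinterval_real[OF k]) auto
    then have "(k has_integral integral {l i..r i} k) {l i<..<r i}"
      using has_integral_open_interval[of k _ "l i" "r i"] by (simp add: integrable_integral)
    then have "((\<lambda>x. if x \<in> {l i<..<r i} then k x else 0) has_integral integral {l i..r i} k) {a..b}"
      using lr[OF i] by (subst has_integral_restrict) auto
    then show ?thesis by (simp add: g_def[abs_def])
  qed
  have "((\<lambda>x. \<Sum>i<n. g i x) has_integral (\<Sum>i<n. integral {l i..r i} k)) {a..b}"
    by (intro has_integral_sum finite_lessThan g) auto
  moreover have "(\<Sum>i<n. g i x) \<le> k x" for x
  proof (cases "\<exists>j<n. x \<in> {l j<..<r j}")
    case True
    then obtain j where j: "j < n" "x \<in> {l j<..<r j}" by blast
    have "g i x = 0" if "i < n" "i \<noteq> j" for i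
      using dis that j unfolding disjoint_family_on_def g_def by fastforce
    then have "(\<Sum>i\<in>{..<n}-{j}. g i x) = 0" by (intro sum.neutral) auto
    then have "(\<Sum>i<n. g i x) = g j x" using j by (simp add: sum.remove[of "{..<n}" j])
    then show ?thesis using j by (simp add: g_def)
  next
    case False
    then have "(\<Sum>i<n. g i x) = 0" by (intro sum.neutral) (auto simp: g_def)
    then show ?thesis using pos by simp
  qed
  ultimately show ?thesis
    using has_integral_le[OF _ integrable_integral[OF k]] by blast
qed

text \<open>Truncation: \<open>norm (f x)\<close> splits at height \<open>N\<close> into a bounded
  part, controlled by the total length, and an excess \<open>k N\<close>, whose integral over the
  whole interval is small for large \<open>N\<close> by dominated convergence.\<close>

lemma prim_AC_loc:
  assumes f: "loc_int f"
  shows "prim f \<in> AC_loc UNIV"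
  unfolding AC_loc_def absolutely_continuous_on_interval_def
proof (intro CollectI conjI allI impI subset_UNIV)
  fix a b \<epsilon> :: real assume \<epsilon>: "\<epsilon> > 0"
  define m where "m x = norm (f x)" for x
  define k where "k N x = m x - min (m x) (real N)" for N x
  have m: "loc_int m" unfolding m_def[abs_def] by (rule loc_int_norm[OF f])
  have minm: "(\<lambda>x. min (m x) (real N)) absolutely_integrable_on {c..d}" for N c d
    using absolutely_integrable_min_1[OF loc_intD[OF m] loc_intD[OF loc_int_const]] .
  have k: "k N absolutely_integrable_on {c..d}" for N c d
    unfolding k_def[abs_def] by (intro set_integral_diff(1) loc_intD[OF m] minm)
  have lim: "(\<lambda>N. integral {a..b} (k N)) \<longlonglongrightarrow> integral {a..b} (\<lambda>_. 0)"
  proof (rule dominated_convergence(2))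
    show "k N integrable_on {a..b}" for N using k by (rule set_lebesgue_integral_eq_integral(1))
    show "m integrable_on {a..b}" by (rule loc_int_integrable[OF m])
    show "norm (k N x) \<le> m x" for N x by (auto simp: k_def m_def)
    show "(\<lambda>N. k N x) \<longlonglongrightarrow> 0" for x
    proof (rule tendsto_eventually)
      obtain N0 where "m x \<le> real N0" using real_arch_simple by blast
      then show "\<forall>\<^sub>F N in sequentially. k N x = 0"
        by (intro eventually_sequentiallyI[of N0]) (auto simp: k_def min_def)
    qed
  qed
  then have "\<forall>\<^sub>F N in sequentially. integral {a..b} (k N) < \<epsilon> / 2"
    using \<epsilon> by (intro order_tendstoD(2)[OF lim]) simp
  then obtain N where N: "integral {a..b} (k N) < \<epsilon> / 2" by (auto simp: eventually_sequentially)
  show "\<exists>\<delta>>0. \<forall>(n::nat) l r. (\<forall>i<n. a \<le> l i \<and> l i \<le> r i \<and> r i \<le> b) \<longrightarrow>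
        disjoint_family_on (\<lambda>i. {l i<..<r i}) {..<n} \<longrightarrow> (\<Sum>i<n. r i - l i) < \<delta> \<longrightarrow>
        (\<Sum>i<n. dist (prim f (l i)) (prim f (r i))) < \<epsilon>"
  \<comment> \<open>Within this length the bounded part contributes less than
    \<open>\<epsilon> / 2\<close>; the \<open>+ 1\<close> keeps the quotient meaningful for
    \<open>N = 0\<close>.\<close>
  proof (intro exI[of _ "\<epsilon> / (2 * (real N + 1))"] conjI allI impI)
    show "0 < \<epsilon> / (2 * (real N + 1))" using \<epsilon> by simp
    fix n :: nat and l r
    assume lr: "\<forall>i<n. a \<le> l i \<and> l i \<le> r i \<and> r i \<le> b"
      and dis: "disjoint_family_on (\<lambda>i. {l i<..<r i}) {..<n}"
      and len: "(\<Sum>i<n. r i - l i) < \<epsilon> / (2 * (real N + 1))"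
    have "(\<Sum>i<n. dist (prim f (l i)) (prim f (r i))) \<le> (\<Sum>i<n. integral {l i..r i} (k N) + real N * (r i - l i))"
    proof (rule sum_mono)
      fix i assume "i \<in> {..<n}"
      then have i: "l i \<le> r i" using lr by auto
      have "dist (prim f (l i)) (prim f (r i)) = norm (integral {l i..r i} f)"
        using prim_diff[OF f i] by (metis dist_commute dist_norm)
      also have "\<dots> \<le> integral {l i..r i} m"
        by (rule integral_norm_bound_integral[OF loc_int_integrable[OF f] loc_int_integrable[OF m]])
           (simp add: m_def)
      also have "\<dots> \<le> integral {l i..r i} (\<lambda>x. k N x + real N)"
        by (rule integral_le[OF loc_int_integrable[OF m]])
           (auto simp: k_def intro!: integrable_add set_lebesgue_integral_eq_integral(1)[OF k[unfolded k_def[abs_def]]])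
      also have "\<dots> = integral {l i..r i} (k N) + real N * (r i - l i)"
        using i set_lebesgue_integral_eq_integral(1)[OF k, of N "l i" "r i"]
        by (subst Henstock_Kurzweil_Integration.integral_add) (auto simp: mult.commute)
      finally show "dist (prim f (l i)) (prim f (r i)) \<le> integral {l i..r i} (k N) + real N * (r i - l i)" .
    qed
    also have "\<dots> = (\<Sum>i<n. integral {l i..r i} (k N)) + real N * (\<Sum>i<n. r i - l i)"
      by (simp add: sum.distrib sum_distrib_left)
    also have "(\<Sum>i<n. integral {l i..r i} (k N)) \<le> integral {a..b} (k N)"
      by (rule sum_integral_disjoint_le[OF set_lebesgue_integral_eq_integral(1)[OF k] _ _ dis])
         (use lr in \<open>auto simp: k_def\<close>)
    also have "real N * (\<Sum>i<n. r i - l i) \<le> (real N + 1) * (\<Sum>i<n. r i - l i)"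
      using lr by (intro mult_right_mono sum_nonneg) auto
    also have "\<dots> < (real N + 1) * (\<epsilon> / (2 * (real N + 1)))" using len by (intro mult_strict_left_mono) auto
    also have "\<dots> = \<epsilon> / 2" by (simp add: divide_simps)
    finally show "(\<Sum>i<n. dist (prim f (l i)) (prim f (r i))) < \<epsilon>" using N by simp
  qed
qed

text \<open>Lebesgue differentiation in the form of \<open>integrable_ccontinuous_explicit\<close>
  concerns averages to the right of a point. Applied to the reflection \<open>g\<close> it yields
  the averages to the left, with exceptional set \<open>uminus\<close> followed by the image of
  \<open>N2\<close>, which is again null.\<close>

lemma prim_has_vector_derivative_AE:
  assumes f: "loc_int f"
  shows "AE x in lebesgue. (prim f has_vector_derivative f x) (at x)"
proof -
  define g where "g x = f (- x)" for x
  have gi: "integral {-b..-a} g = integral {a..b} f" "g integrable_on {-b..-a}" for a b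
    using loc_int_integrable[OF f, of a b] by (auto simp: g_def[abs_def])
  have gi2: "g integrable_on {a..b}" for a b using gi(2)[of "-a" "-b"] by simp
  obtain N1 where N1: "negligible N1" and d1: "\<And>x e. \<lbrakk>x \<notin> N1; 0 < e\<rbrakk> \<Longrightarrow>
       \<exists>d>0. \<forall>h. 0 < h \<and> h < d \<longrightarrow> norm(integral (cbox x (x + h *\<^sub>R One)) f /\<^sub>R h ^ DIM(real) - f x) < e"
    by (rule integrable_ccontinuous_explicit[of f]) (use loc_int_integrable[OF f] in auto)
  obtain N2 where N2: "negligible N2" and d2: "\<And>x e. \<lbrakk>x \<notin> N2; 0 < e\<rbrakk> \<Longrightarrow>
       \<exists>d>0. \<forall>h. 0 < h \<and> h < d \<longrightarrow> norm(integral (cbox x (x + h *\<^sub>R One)) g /\<^sub>R h ^ DIM(real) - g x) < e"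
    by (rule integrable_ccontinuous_explicit[of g]) (use gi2 in auto)
  have "negligible (uminus ` N2)"
    by (rule negligible_differentiable_image_negligible[OF _ N2]) (auto intro!: derivative_intros simp: differentiable_on_def)
  with N1 have N: "N1 \<union> uminus ` N2 \<in> null_sets lebesgue"
    by (simp add: negligible_iff_null_sets[symmetric] negligible_Un)
  have "(prim f has_vector_derivative f x) (at x)" if x: "x \<notin> N1 \<union> uminus ` N2" for x
    unfolding has_vector_derivative_def has_derivative_at_alt
  proof (intro conjI allI impI bounded_linear_scaleR_left)
    fix e :: real assume e: "e > 0"
    obtain da where da: "da > 0" "\<And>h. 0 < h \<Longrightarrow> h < da \<Longrightarrow> norm (integral {x..x+h} f /\<^sub>R h - f x) < e"
      using d1[of x, OF _ e] x by auto
    have "- x \<notin> N2" using x by (metis UnI2 add.inverse_inverse image_eqI)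
    then obtain db where db: "db > 0" "\<And>h. 0 < h \<Longrightarrow> h < db \<Longrightarrow> norm (integral {-x..-x+h} g /\<^sub>R h - f x) < e"
      using d2[of "-x", OF _ e] by (auto simp: g_def)
    have scale: "norm (I - h *\<^sub>R f x) \<le> e * h" if "norm (I /\<^sub>R h - f x) < e" "h > 0" for I h
    proof -
      have "I - h *\<^sub>R f x = h *\<^sub>R (I /\<^sub>R h - f x)" using that by (simp add: scaleR_diff_right)
      then have "norm (I - h *\<^sub>R f x) = h * norm (I /\<^sub>R h - f x)" using that by simp
      also have "\<dots> \<le> h * e" using that by (intro mult_left_mono) auto
      finally show ?thesis by (simp add: mult.commute)
    qed
    show "\<exists>d>0. \<forall>y. norm (y - x) < d \<longrightarrow> norm (prim f y - prim f x - (y - x) *\<^sub>R f x) \<le> e * norm (y - x)"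
    proof (intro exI[of _ "min da db"] conjI allI impI)
      show "min da db > 0" using da db by simp
      fix y assume y: "norm (y - x) < min da db"
      consider "y = x" | "y > x" | "y < x" by linarith
      then show "norm (prim f y - prim f x - (y - x) *\<^sub>R f x) \<le> e * norm (y - x)"
      proof cases
        case 1 then show ?thesis by simp
      next
        case 2
        have "norm (integral {x..x + (y - x)} f - (y - x) *\<^sub>R f x) \<le> e * (y - x)"
          using 2 y by (intro scale da(2)) auto
        then show ?thesis using 2 prim_diff[OF f, of x y] by simp
      next
        case 3
        have "norm (integral {-x..-x + (x - y)} g - (x - y) *\<^sub>R f x) \<le> e * (x - y)"
          using 3 y by (intro scale db(2)) auto
        moreover have "integral {-x..-x + (x - y)} g = prim f x - prim f y"
          using gi(1)[of x y] 3 prim_diff[OF f, of y x] by simp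
        moreover have "prim f y - prim f x - (y - x) *\<^sub>R f x = - (prim f x - prim f y - (x - y) *\<^sub>R f x)"
          by (simp add: algebra_simps)
        ultimately show ?thesis using 3 by (metis abs_minus_commute abs_of_pos diff_gt_0_iff_gt norm_minus_cancel real_norm_def)
      qed
    qed
  qed
  then show ?thesis using N by (intro AE_I') auto
qed

text \<open>\<open>F - prim g\<close> and its negative both have derivative 0 almost everywhere, so
  both are nonincreasing and the difference is constant.\<close>

lemma AC_loc_FTC:
  fixes F g :: "real \<Rightarrow> real"
  assumes F: "F \<in> AC_loc UNIV" and g: "loc_int g"
    and der: "AE x in lebesgue. (F has_real_derivative g x) (at x)" and ab: "a \<le> b"
  shows "integral {a..b} g = F b - F a"
proof -
  define H where "H c x = c * (F x + (- 1) * prim g x)" for c x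
  have AC: "H c \<in> AC_loc UNIV" for c
    unfolding H_def[abs_def] by (intro AC_loc_cmult AC_loc_add F prim_AC_loc[OF g])
  have D: "AE x in lebesgue. \<exists>D\<le>0. (H c has_real_derivative D) (at x)" for c
    using der prim_has_vector_derivative_AE[OF g]
  proof eventually_elim
    case (elim x)
    then have "(H c has_real_derivative c * (g x + (- 1) * g x)) (at x)"
      unfolding H_def[abs_def] has_real_derivative_iff_has_vector_derivative[symmetric]
      by (intro derivative_intros DERIV_cmult) auto
    then show ?case by (intro exI[of _ 0]) simp
  qed
  have "H 1 b \<le> H 1 a" "H (-1) b \<le> H (-1) a" by (rule AC_loc_nonincreasing[OF AC D ab])+
  then show ?thesis using prim_diff[OF g ab] by (simp add: H_def)
qed

text \<open>The bound on \<open>\<bar>D\<bar>\<close> makes \<open>F * exp (- prim m)\<close>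
  nonincreasing and \<open>F * exp (prim m)\<close> nondecreasing. The first carries the zero at
  \<open>x0\<close> to the right, the second to the left; \<open>s\<close> selects the
  direction.\<close>

lemma AC_loc_Gronwall_zero:
  fixes F m :: "real \<Rightarrow> real"
  assumes F: "F \<in> AC_loc UNIV" and m: "loc_int m"
    and der: "AE x in lebesgue. \<exists>D. (F has_real_derivative D) (at x) \<and> \<bar>D\<bar> \<le> m x * F x"
    and zero: "F x0 = 0" and nonneg: "\<And>x. F x \<ge> 0"
  shows "F x = 0"
proof -
  define H where "H s x = s * (F x * exp (- s * prim m x))" for s x
  have AC: "H s \<in> AC_loc UNIV" for s
    unfolding H_def[abs_def] by (intro AC_loc_cmult AC_loc_mult AC_loc_exp F prim_AC_loc[OF m])
  have D: "AE x in lebesgue. \<exists>D\<le>0. (H s has_real_derivative D) (at x)" if s: "s = 1 \<or> s = -1" for s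
    using der prim_has_vector_derivative_AE[OF m]
  proof eventually_elim
    case (elim x)
    then obtain D where D: "(F has_real_derivative D) (at x)" "\<bar>D\<bar> \<le> m x * F x" by blast
    have M: "(prim m has_real_derivative m x) (at x)"
      using elim by (simp add: has_real_derivative_iff_has_vector_derivative)
    have "(H s has_real_derivative s * (D * exp (- s * prim m x) + exp (- s * prim m x) * (- s * m x) * F x)) (at x)"
      unfolding H_def[abs_def]
      by (rule DERIV_cmult[OF DERIV_mult[OF D(1) DERIV_fun_exp[OF DERIV_cmult[OF M]]]])
    moreover have "s * (D * exp (- s * prim m x) + exp (- s * prim m x) * (- s * m x) * F x)
        = exp (- s * prim m x) * (s * D - (s * s) * (m x * F x))"
      by (simp add: algebra_simps)
    moreover have "\<dots> \<le> 0" using s D(2) by (intro mult_nonneg_nonpos) auto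
    ultimately show ?case by metis
  qed
  show ?thesis
  proof (cases "x0 \<le> x")
    case True
    have "H 1 x \<le> H 1 x0" by (rule AC_loc_nonincreasing[OF AC D True]) simp
    then have "F x * exp (- prim m x) \<le> 0" using zero by (simp add: H_def)
    then have "F x \<le> 0" by (simp add: mult_le_0_iff)
    then show ?thesis using nonneg[of x] by simp
  next
    case False
    then have "H (-1) x0 \<le> H (-1) x" by (intro AC_loc_nonincreasing[OF AC D]) auto
    then have "F x * exp (prim m x) \<le> 0" using zero by (simp add: H_def)
    then have "F x \<le> 0" by (simp add: mult_le_0_iff)
    then show ?thesis using nonneg[of x] by simp
  qed
qed

section \<open>Iterated integrals as repeated primitives\<close>

text \<open>Fubini with the new coordinate outermost. The recursion needs this order because the
  last coordinate of a simplex bounds all the others.\<close>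

lemma (in product_sigma_finite) product_integral_insert_rev:
  fixes f :: "_ \<Rightarrow> _::{banach, second_countable_topology}"
  assumes I: "finite I" "i \<notin> I" and f: "integrable (Pi\<^sub>M (insert i I) M) f"
  shows "integral\<^sup>L (Pi\<^sub>M (insert i I) M) f = (\<integral>y. (\<integral>x. f (x(i := y)) \<partial>Pi\<^sub>M I M) \<partial>M i)"
proof -
  interpret finite_product_sigma_finite M I by standard (rule I)
  interpret P: pair_sigma_finite "Pi\<^sub>M I M" "M i" ..
  have fm[measurable]: "f \<in> borel_measurable (Pi\<^sub>M (insert i I) M)" using f by auto
  have meas[measurable]: "(\<lambda>(x, y). f (x(i := y))) \<in> borel_measurable (Pi\<^sub>M I M \<Otimes>\<^sub>M M i)"
    using measurable_comp[OF measurable_add_dim fm] by (simp add: comp_def case_prod_beta)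
  have "integrable (Pi\<^sub>M I M \<Otimes>\<^sub>M M i) (\<lambda>(x, y). f (x(i := y)))"
  proof (rule integrableI_bounded[OF meas])
    have "(\<integral>\<^sup>+ p. ennreal (norm (case p of (x, y) \<Rightarrow> f (x(i := y)))) \<partial>(Pi\<^sub>M I M \<Otimes>\<^sub>M M i))
        = (\<integral>\<^sup>+ x. \<integral>\<^sup>+ y. ennreal (norm (f (x(i := y)))) \<partial>M i \<partial>Pi\<^sub>M I M)"
      by (subst sigma_finite_measure.nn_integral_fst[OF sigma_finite_measures, symmetric]) (auto simp: case_prod_beta intro!: measurable_compose[OF meas[unfolded case_prod_beta]])
    also have "\<dots> = (\<integral>\<^sup>+ x. ennreal (norm (f x)) \<partial>Pi\<^sub>M (insert i I) M)"
      by (subst product_nn_integral_insert[OF I]) auto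
    also have "\<dots> < \<infinity>" using f by (simp add: integrable_iff_bounded)
    finally show "(\<integral>\<^sup>+ p. ennreal (norm (case p of (x, y) \<Rightarrow> f (x(i := y)))) \<partial>(Pi\<^sub>M I M \<Otimes>\<^sub>M M i)) < \<infinity>" .
  qed
  from P.Fubini_integral[OF this] show ?thesis
    by (simp add: product_integral_insert[OF I f])
qed

lemma sigma_finite_lebesgue: "sigma_finite_measure (lebesgue :: 'a::euclidean_space measure)"
proof
  show "\<exists>A::'a set set. countable A \<and> A \<subseteq> sets lebesgue \<and> \<Union>A = space lebesgue \<and> (\<forall>a\<in>A. emeasure lebesgue a \<noteq> \<infinity>)"
  proof (intro exI[of _ "range (\<lambda>n::nat. ball (0::'a) (real n))"] conjI)
    show "\<Union>(range (\<lambda>n::nat. ball (0::'a) (real n))) = space lebesgue"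
      using reals_Archimedean2 by (auto simp: space_completion)
    show "\<forall>a\<in>range (\<lambda>n::nat. ball (0::'a) (real n)). emeasure lebesgue a \<noteq> \<infinity>"
      using emeasure_bounded_finite[OF bounded_ball] by (auto simp: less_top[symmetric])
  qed auto
qed

lemma loc_int_measurable:
  fixes f :: "real \<Rightarrow> 'a::euclidean_space"
  assumes f: "loc_int f"
  shows "f \<in> borel_measurable lebesgue"
proof (rule borel_measurable_LIMSEQ_metric)
  show "(\<lambda>x. indicator {- real n..real n} x *\<^sub>R f x) \<in> borel_measurable lebesgue" for n
    using loc_intD[OF f] unfolding set_integrable_def by (rule borel_measurable_integrable)
  show "(\<lambda>n. indicator {- real n..real n} x *\<^sub>R f x) \<longlonglongrightarrow> f x" for x
  proof (rule tendsto_eventually)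
    obtain N where N: "\<bar>x\<bar> \<le> real N" using real_arch_simple by blast
    show "\<forall>\<^sub>F n in sequentially. indicator {- real n..real n} x *\<^sub>R f x = f x"
    proof (rule eventually_sequentiallyI[of N])
      fix n assume "N \<le> n"
      then have "\<bar>x\<bar> \<le> real n" using N by linarith
      then have "x \<in> {- real n..real n}" by auto
      then show "indicator {- real n..real n} x *\<^sub>R f x = f x" by simp
    qed
  qed
qed

definition biv_factor :: "(real \<Rightarrow> complex) \<Rightarrow> (real \<Rightarrow> complex) \<Rightarrow> nat \<Rightarrow> real \<Rightarrow> complex" where
  "biv_factor u v i t = (if odd i then u t else v t)"

text \<open>Taking \<open>R\<close> to be \<open>(<)\<close> or \<open>(>)\<close> treats the simplices for \<open>x \<ge> 0\<close> and \<open>x \<le> 0\<close> together.\<close>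
definition simplex_integral ::
    "(real \<Rightarrow> real \<Rightarrow> bool) \<Rightarrow> nat \<Rightarrow> (real \<Rightarrow> complex) \<Rightarrow> (real \<Rightarrow> complex) \<Rightarrow> real \<Rightarrow> complex" where
  "simplex_integral R j u v x = set_lebesgue_integral (\<Pi>\<^sub>M i\<in>{1..j}. lebesgue)
     {s. monotone_on {1..j} (<) R s \<and> (\<forall>i\<in>{1..j}. R 0 (s i) \<and> R (s i) x)} (alternating_product j u v)"

lemma simplex_integral_0: "simplex_integral R 0 u v x = 1"
proof -
  have 1: "{s :: nat \<Rightarrow> real. monotone_on {} (<) R s} = UNIV" by (auto simp: monotone_on_def)
  show ?thesis
    by (simp add: simplex_integral_def set_lebesgue_integral_def alternating_product_def 1 PiM_empty
      lebesgue_integral_count_space_finite)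
qed

text \<open>With the last coordinate fixed at \<open>t\<close>, the remaining ones range over a
  simplex of the same kind with end point \<open>t\<close> instead of \<open>x\<close>, so Fubini
  yields the recursion.\<close>

lemma simplex_integral_Suc:
  assumes R: "R = (<) \<or> R = (>)" and u: "loc_int u" and v: "loc_int v"
  shows "simplex_integral R (Suc j) u v x
    = set_lebesgue_integral lebesgue {t. R 0 t \<and> R t x} (\<lambda>t. biv_factor u v (Suc j) t * simplex_integral R j u v t)"
proof -
  interpret product_sigma_finite "\<lambda>_::nat. lebesgue :: real measure"
    by (intro product_sigma_finite.intro sigma_finite_lebesgue)
  define J where "J = {t. R 0 t \<and> R t x}"
  define D where "D j x = {s. monotone_on {1..j} (<) R s \<and> (\<forall>i\<in>{1..j}. R 0 (s i) \<and> R (s i) x)}" for j :: nat and x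
  define w where "w = biv_factor u v"
  define f where "f s = indicator (D (Suc j) x) s *\<^sub>R (\<Prod>i=1..Suc j. w i (s i))" for s
  have alt: "alternating_product k u v s = (\<Prod>i=1..k. w i (s i))" for k s
    by (simp add: alternating_product_def w_def biv_factor_def)
  have ins: "{1..Suc j} = insert (Suc j) {1..j}" by auto
  have w: "loc_int (w i)" for i using u v by (cases "odd i") (auto simp: w_def biv_factor_def[abs_def])
  have J: "J \<subseteq> {min 0 x..max 0 x}" "J \<in> sets lebesgue"
  proof -
    have "J = {0<..<x} \<or> J = {x<..<0}" using R by (auto simp: J_def)
    then show "J \<subseteq> {min 0 x..max 0 x}" "J \<in> sets lebesgue" by auto
  qed
  have compm: "(\<lambda>s :: nat \<Rightarrow> real. s i) \<in> borel_measurable (\<Pi>\<^sub>M i\<in>{1..Suc j}. lebesgue)" if "i \<in> {1..Suc j}" for i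
  proof -
    have "(\<lambda>t::real. t) \<in> borel_measurable lebesgue" by (intro measurable_completion) simp
    from measurable_compose[OF measurable_component_singleton[OF that] this] show ?thesis by simp
  qed
  have Dm: "D (Suc j) x \<inter> space (\<Pi>\<^sub>M i\<in>{1..Suc j}. lebesgue) \<in> sets (\<Pi>\<^sub>M i\<in>{1..Suc j}. lebesgue)"
  proof -
    have Rm: "Measurable.pred M (\<lambda>s. R (g s) (h s))" if "g \<in> borel_measurable M" "h \<in> borel_measurable M"
      for M :: "(nat \<Rightarrow> real) measure" and g h
      using R that borel_measurable_pred_less[of g M h] borel_measurable_pred_less[of h M g] by auto
    have "Measurable.pred (\<Pi>\<^sub>M i\<in>{1..Suc j}. lebesgue) (\<lambda>s. (\<forall>i\<in>{1..Suc j}. \<forall>k\<in>{1..Suc j}. i < k \<longrightarrow> R (s i) (s k)) \<and>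
        (\<forall>i\<in>{1..Suc j}. R 0 (s i) \<and> R (s i) x))"
      by (intro pred_intros_logic pred_intros_finite Rm compm borel_measurable_const) auto
    moreover have "D (Suc j) x \<inter> space (\<Pi>\<^sub>M i\<in>{1..Suc j}. lebesgue) = {s \<in> space (\<Pi>\<^sub>M i\<in>{1..Suc j}. lebesgue).
       (\<forall>i\<in>{1..Suc j}. \<forall>k\<in>{1..Suc j}. i < k \<longrightarrow> R (s i) (s k)) \<and> (\<forall>i\<in>{1..Suc j}. R 0 (s i) \<and> R (s i) x)}"
      unfolding D_def monotone_on_def by blast
    ultimately show ?thesis by (simp only: pred_def)
  qed
  have prodm: "(\<lambda>s. \<Prod>i=1..Suc j. w i (s i)) \<in> borel_measurable (\<Pi>\<^sub>M i\<in>{1..Suc j}. lebesgue)"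
    by (intro borel_measurable_prod measurable_compose[OF measurable_component_singleton] loc_int_measurable[OF w])
  have fm: "f \<in> borel_measurable (\<Pi>\<^sub>M i\<in>{1..Suc j}. lebesgue)"
    unfolding f_def[abs_def] by (intro borel_measurable_scaleR borel_measurable_indicator' prodm)
      (use Dm in \<open>simp add: Int_def conj_commute\<close>)
  \<comment> \<open>Fubini needs integrability on the simplex. It follows by domination from the
    surrounding cube, where the integrand is a product of integrable functions of one
    variable.\<close>
  have "integrable (\<Pi>\<^sub>M i\<in>{1..Suc j}. lebesgue) (\<lambda>s. \<Prod>i=1..Suc j. indicator J (s i) *\<^sub>R w i (s i))"
  proof (rule product_integrable_prod)
    fix i
    show "integrable lebesgue (\<lambda>t. indicator J t *\<^sub>R w i t)"
      using set_integrable_subset[OF loc_intD[OF w] J(2) J(1)] by (simp add: set_integrable_def)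
  qed simp
  then have fi: "integrable (\<Pi>\<^sub>M i\<in>{1..Suc j}. lebesgue) f"
  proof (rule Bochner_Integration.integrable_bound[OF _ fm AE_I2])
    fix s :: "nat \<Rightarrow> real"
    show "norm (f s) \<le> norm (\<Prod>i=1..Suc j. indicator J (s i) *\<^sub>R w i (s i))"
    proof (cases "s \<in> D (Suc j) x")
      case True
      then have "\<And>i. i \<in> {1..Suc j} \<Longrightarrow> s i \<in> J" by (auto simp: D_def J_def)
      then have "(\<Prod>i=1..Suc j. indicator J (s i) *\<^sub>R w i (s i)) = (\<Prod>i=1..Suc j. w i (s i))"
        by (intro prod.cong) auto
      then show ?thesis using True by (simp add: f_def)
    next
      case False then show ?thesis by (simp add: f_def)
    qed
  qed
  \<comment> \<open>The fibre of the simplex over its last coordinate. The bound by \<open>x\<close>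
    on the earlier coordinates is recovered from transitivity of \<open>R\<close>.\<close>
  have D: "s(Suc j := y) \<in> D (Suc j) x \<longleftrightarrow> y \<in> J \<and> s \<in> D j y" for s y
  proof
    assume L: "s(Suc j := y) \<in> D (Suc j) x"
    have mono: "R ((s(Suc j := y)) a) ((s(Suc j := y)) b)" if "a \<in> {1..Suc j}" "b \<in> {1..Suc j}" "a < b" for a b
      using L that unfolding D_def monotone_on_def by blast
    have bnd: "R 0 ((s(Suc j := y)) a)" "R ((s(Suc j := y)) a) x" if "a \<in> {1..Suc j}" for a
      using L that unfolding D_def by blast+
    have "R 0 y" "R y x" using bnd[of "Suc j"] by auto
    moreover have "R (s i) y" "R 0 (s i)" if "i \<in> {1..j}" for i
      using mono[of i "Suc j"] bnd(1)[of i] that by auto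
    moreover have "R (s i) (s k)" if "i \<in> {1..j}" "k \<in> {1..j}" "i < k" for i k
      using mono[of i k] that by auto
    ultimately show "y \<in> J \<and> s \<in> D j y" by (auto simp: D_def J_def monotone_on_def)
  next
    assume A: "y \<in> J \<and> s \<in> D j y"
    have R0: "R (s i) y" "R 0 (s i)" if "i \<in> {1..j}" for i using A that by (auto simp: D_def)
    have R1: "R (s i) (s k)" if "i \<in> {1..j}" "k \<in> {1..j}" "i < k" for i k
      using A that by (auto simp: D_def monotone_on_def)
    have R2: "R 0 y" "R y x" using A by (auto simp: J_def)
    have R3: "R (s i) x" if "i \<in> {1..j}" for i using R0(1)[OF that] R2(2) R by auto
    show "s(Suc j := y) \<in> D (Suc j) x"
      unfolding D_def monotone_on_def
      using R0 R1 R2 R3 by (auto simp: le_Suc_eq)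
  qed
  have "simplex_integral R (Suc j) u v x = integral\<^sup>L (\<Pi>\<^sub>M i\<in>{1..Suc j}. lebesgue) f"
    by (simp add: simplex_integral_def set_lebesgue_integral_def alt f_def[abs_def] D_def)
  also have "\<dots> = (\<integral>y. (\<integral>s. f (s(Suc j := y)) \<partial>(\<Pi>\<^sub>M i\<in>{1..j}. lebesgue)) \<partial>lebesgue)"
    unfolding ins by (rule product_integral_insert_rev[OF _ _ fi[unfolded ins]]) auto
  also have "\<dots> = (\<integral>y. indicator J y *\<^sub>R (w (Suc j) y * simplex_integral R j u v y) \<partial>lebesgue)"
  proof (intro Bochner_Integration.integral_cong refl)
    fix y
    have prod: "(\<Prod>i=1..Suc j. w i ((s(Suc j := y)) i)) = w (Suc j) y * (\<Prod>i=1..j. w i (s i))" for s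
      unfolding ins by (subst prod.insert) (auto intro!: prod.cong)
    have "f (s(Suc j := y)) = (indicator J y *\<^sub>R w (Suc j) y) * (indicator (D j y) s *\<^sub>R (\<Prod>i=1..j. w i (s i)))" for s
      unfolding f_def prod using D[of s y] by (auto simp: indicator_def)
    then have "(\<integral>s. f (s(Suc j := y)) \<partial>(\<Pi>\<^sub>M i\<in>{1..j}. lebesgue))
       = (indicator J y *\<^sub>R w (Suc j) y) * (\<integral>s. indicator (D j y) s *\<^sub>R (\<Prod>i=1..j. w i (s i)) \<partial>(\<Pi>\<^sub>M i\<in>{1..j}. lebesgue))"
      by (simp only: integral_mult_right_zero)
    also have "(\<integral>s. indicator (D j y) s *\<^sub>R (\<Prod>i=1..j. w i (s i)) \<partial>(\<Pi>\<^sub>M i\<in>{1..j}. lebesgue)) = simplex_integral R j u v y"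
      by (simp add: simplex_integral_def set_lebesgue_integral_def alt D_def)
    finally show "(\<integral>s. f (s(Suc j := y)) \<partial>(\<Pi>\<^sub>M i\<in>{1..j}. lebesgue))
       = indicator J y *\<^sub>R (w (Suc j) y * simplex_integral R j u v y)" by (simp only: mult_scaleR_left)
  qed
  finally show ?thesis by (simp add: set_lebesgue_integral_def J_def w_def)
qed

lemma biv_A_0 [simp]: "biv_A 0 u v x = 1"
  by (simp add: biv_A_def)

lemma biv_A_simplex_integral:
  "0 \<le> x \<Longrightarrow> biv_A j u v x = simplex_integral (<) j u v x"
  "x < 0 \<Longrightarrow> biv_A j u v x = (-1) ^ j * simplex_integral (>) j u v x"
  by (cases j; simp add: simplex_integral_0 biv_A_def; simp add: simplex_integral_def conj_commute)+

lemma loc_int_biv_factor: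
  assumes "loc_int u" "loc_int v" "continuous_on UNIV g"
  shows "loc_int (\<lambda>t. biv_factor u v i t * g t)"
  using assms by (cases "odd i") (auto simp: biv_factor_def intro: loc_int_mult_continuous)

text \<open>Continuity of \<open>biv_A j u v\<close> makes the integrand locally integrable. It is
  assumed here because \<open>continuous_on_biv_A\<close> derives it by induction from this very
  recursion; \<open>biv_A_Suc\<close> then discharges it.\<close>

lemma biv_A_Suc':
  assumes u: "loc_int u" and v: "loc_int v" and cont: "continuous_on UNIV (biv_A j u v)"
  shows "biv_A (Suc j) u v x = prim (\<lambda>t. biv_factor u v (Suc j) t * biv_A j u v t) x"
proof -
  define g where "g t = biv_factor u v (Suc j) t * biv_A j u v t" for t
  have g: "loc_int g" unfolding g_def[abs_def] by (rule loc_int_biv_factor[OF u v cont])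
  have open_eq: "set_lebesgue_integral lebesgue {a<..<b} g = integral {a..b} g" for a b
  proof -
    have "g absolutely_integrable_on {a<..<b}"
      by (rule set_integrable_subset[OF loc_intD[OF g, of a b]]) auto
    then have "set_lebesgue_integral lebesgue {a<..<b} g = integral {a<..<b} g"
      by (rule set_lebesgue_integral_eq_integral(2))
    then show ?thesis using integral_open_interval[of a b g] by simp
  qed
  show ?thesis
  proof (cases "0 \<le> x")
    case True
    have "biv_A (Suc j) u v x = set_lebesgue_integral lebesgue {t. 0 < t \<and> t < x}
        (\<lambda>t. biv_factor u v (Suc j) t * simplex_integral (<) j u v t)"
      using True by (simp add: biv_A_simplex_integral simplex_integral_Suc[OF _ u v])
    also have "\<dots> = set_lebesgue_integral lebesgue {0<..<x} g"
      unfolding set_lebesgue_integral_def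
      by (intro Bochner_Integration.integral_cong refl) (auto simp: indicator_def g_def biv_A_simplex_integral)
    finally show ?thesis using True open_eq by (simp add: prim_def g_def[abs_def])
  next
    case False
    have "biv_A (Suc j) u v x = (-1) ^ Suc j * set_lebesgue_integral lebesgue {t. 0 > t \<and> t > x}
        (\<lambda>t. biv_factor u v (Suc j) t * simplex_integral (>) j u v t)"
      using False by (simp add: biv_A_simplex_integral simplex_integral_Suc[OF _ u v])
    \<comment> \<open>One factor -1 becomes the orientation sign of \<open>prim\<close>; the other
      \<open>j\<close> turn the inner simplex integral back into \<open>biv_A j\<close>.\<close>
    also have "\<dots> = - set_lebesgue_integral lebesgue {t. 0 > t \<and> t > x}
        (\<lambda>t. (-1) ^ j * (biv_factor u v (Suc j) t * simplex_integral (>) j u v t))"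
      by (simp add: set_integral_mult_right)
    also have "set_lebesgue_integral lebesgue {t. 0 > t \<and> t > x}
        (\<lambda>t. (-1) ^ j * (biv_factor u v (Suc j) t * simplex_integral (>) j u v t)) = set_lebesgue_integral lebesgue {x<..<0} g"
      unfolding set_lebesgue_integral_def
      by (intro Bochner_Integration.integral_cong refl) (auto simp: indicator_def g_def biv_A_simplex_integral)
    finally show ?thesis using False open_eq by (simp add: prim_def g_def[abs_def])
  qed
qed

lemma continuous_on_biv_A:
  assumes u: "loc_int u" and v: "loc_int v"
  shows "continuous_on UNIV (biv_A j u v)"
proof (induction j)
  case 0
  have "biv_A 0 u v = (\<lambda>_. 1)" by auto
  then show ?case by simp
next
  case (Suc j)
  have "biv_A (Suc j) u v = prim (\<lambda>t. biv_factor u v (Suc j) t * biv_A j u v t)"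
    by (rule ext) (rule biv_A_Suc'[OF u v Suc])
  then show ?case
    using AC_loc_continuous_on[OF prim_AC_loc[OF loc_int_biv_factor[OF u v Suc]]] by simp
qed

lemma biv_A_Suc:
  assumes "loc_int u" "loc_int v"
  shows "biv_A (Suc j) u v x = prim (\<lambda>t. biv_factor u v (Suc j) t * biv_A j u v t) x"
  by (rule biv_A_Suc'[OF assms continuous_on_biv_A[OF assms]])

section \<open>The bivariate exponential\<close>

lemma prim_cmult:
  fixes f :: "real \<Rightarrow> 'a::{euclidean_space, real_normed_field}"
  shows "prim (\<lambda>t. c * f t) x = c * prim f x"
  by (simp add: prim_def)

lemma prim_add:
  assumes "loc_int f" "loc_int g"
  shows "prim (\<lambda>t. f t + g t) x = prim f x + prim g x"
  by (simp add: prim_def Henstock_Kurzweil_Integration.integral_add loc_int_integrable assms)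

lemma prim_linear:
  assumes f: "loc_int f" and h: "bounded_linear h"
  shows "prim (\<lambda>t. h (f t)) x = h (prim f x)"
proof -
  have "integral {a..b} (\<lambda>t. h (f t)) = h (integral {a..b} f)" for a b
    using integral_linear[OF loc_int_integrable[OF f] h, of a b] by (simp add: o_def)
  then show ?thesis by (simp add: prim_def linear_neg[OF bounded_linear.linear[OF h]])
qed

lemma
  fixes f :: "real \<Rightarrow> real"
  assumes nonneg: "\<And>t. f t \<ge> 0" and f: "loc_int f"
  shows prim_nonneg: "0 \<le> x \<Longrightarrow> prim f x \<ge> 0" and prim_nonpos: "x \<le> 0 \<Longrightarrow> prim f x \<le> 0"
proof -
  have "integral {a..b} f \<ge> 0" for a b
    by (rule Henstock_Kurzweil_Integration.integral_nonneg[OF loc_int_integrable[OF f] nonneg])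
  then show "0 \<le> x \<Longrightarrow> prim f x \<ge> 0" "x \<le> 0 \<Longrightarrow> prim f x \<le> 0" by (auto simp: prim_def)
qed

text \<open>The antiderivative of \<open>M^j / j!\<close> against \<open>M'\<close> is the next
  power \<open>M^(j+1) / (j+1)!\<close>, by the chain rule almost everywhere. The sign
  \<open>s\<close> allows \<open>M = s * prim m\<close> to be nonnegative on either side of 0 when
  \<open>m\<close> is.\<close>

lemma integral_prim_power:
  fixes m :: "real \<Rightarrow> real"
  assumes m: "loc_int m" and s: "s = 1 \<or> s = -1" and "a \<le> b"
  shows "integral {a..b} (\<lambda>x. m x * ((s * prim m x) ^ j / fact j))
    = s * (s * prim m b) ^ Suc j / fact (Suc j) - s * (s * prim m a) ^ Suc j / fact (Suc j)"
proof -
  define F where "F x = (s / fact (Suc j)) * (s * prim m x) ^ Suc j" for x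
  have AC: "F \<in> AC_loc UNIV"
    unfolding F_def[abs_def] by (intro AC_loc_cmult AC_loc_power prim_AC_loc m)
  have cont: "continuous_on UNIV (\<lambda>x. (s * prim m x) ^ j / fact j)"
    by (intro continuous_intros AC_loc_continuous_on[OF prim_AC_loc[OF m]]) simp
  have der: "AE x in lebesgue. (F has_real_derivative m x * ((s * prim m x) ^ j / fact j)) (at x)"
    using prim_has_vector_derivative_AE[OF m]
  proof eventually_elim
    case (elim x)
    then have M: "(prim m has_real_derivative m x) (at x)"
      by (simp add: has_real_derivative_iff_has_vector_derivative)
    have "(F has_real_derivative (s / fact (Suc j)) * (real (Suc j) * (s * prim m x) ^ (Suc j - Suc 0) * (s * m x))) (at x)"
      unfolding F_def[abs_def]
      using DERIV_cmult[OF DERIV_power[OF DERIV_cmult[OF M]], of "s / fact (Suc j)" s "Suc j"] by (simp add: mult_ac)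
    moreover have "(s / fact (Suc j)) * (real (Suc j) * (s * prim m x) ^ (Suc j - Suc 0) * (s * m x))
        = (s * s) * (m x * ((s * prim m x) ^ j / fact j))"
    proof -
      have "real (Suc j) / fact (Suc j) = 1 / fact j"
        unfolding fact_Suc by (simp del: of_nat_Suc)
      then have "(s * s) * (m x * (s * prim m x) ^ j) * (real (Suc j) / fact (Suc j)) = (s * s) * (m x * (s * prim m x) ^ j) * (1 / fact j)"
        by (simp only:)
      then show ?thesis by (simp add: mult_ac del: of_nat_Suc fact_Suc power_mult_distrib)
    qed
    moreover have "s * s = 1" using s by auto
    ultimately show ?case by (simp only: mult_1_left)
  qed
  show ?thesis
    using AC_loc_FTC[OF AC loc_int_mult_continuous[OF m cont] der \<open>a \<le> b\<close>] by (simp add: F_def)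
qed

text \<open>The sum \<open>norm (u t) + norm (v t)\<close> dominates each factor whatever its
  parity, so the induction follows a single weight and \<open>integral_prim_power\<close> supplies
  the factorial.\<close>

lemma norm_biv_A_le:
  assumes u: "loc_int u" and v: "loc_int v"
  shows "norm (biv_A j u v x) \<le> \<bar>prim (\<lambda>t. norm (u t) + norm (v t)) x\<bar> ^ j / fact j"
proof (induction j arbitrary: x)
  case (Suc j)
  define m where "m t = norm (u t) + norm (v t)" for t
  have m: "loc_int m" unfolding m_def[abs_def] by (intro loc_int_add loc_int_norm u v)
  have m0: "m t \<ge> 0" for t by (simp add: m_def)
  define g where "g t = biv_factor u v (Suc j) t * biv_A j u v t" for t
  have g: "loc_int g" unfolding g_def[abs_def] by (rule loc_int_biv_factor[OF u v continuous_on_biv_A[OF u v]])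
  have gle: "norm (g t) \<le> m t * (\<bar>prim m t\<bar> ^ j / fact j)" for t
    unfolding g_def norm_mult using Suc.IH[of t]
    by (intro mult_mono) (auto simp: biv_factor_def m_def[abs_def])
  have hint: "(\<lambda>t. m t * ((s * prim m t) ^ j / fact j)) integrable_on {a..b}" for a b s
    by (intro loc_int_integrable loc_int_mult_continuous[OF m] continuous_intros
        AC_loc_continuous_on[OF prim_AC_loc[OF m]]) simp
  have "norm (prim g x) \<le> \<bar>prim m x\<bar> ^ Suc j / fact (Suc j)"
  proof (cases "0 \<le> x")
    case True
    have "norm (integral {0..x} g) \<le> integral {0..x} (\<lambda>t. m t * ((1 * prim m t) ^ j / fact j))"
    proof (rule integral_norm_bound_integral[OF loc_int_integrable[OF g] hint])
      fix t assume "t \<in> {0..x}"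
      then show "norm (g t) \<le> m t * ((1 * prim m t) ^ j / fact j)"
        using gle[of t] prim_nonneg[OF m0 m, of t] by simp
    qed
    also have "\<dots> = prim m x ^ Suc j / fact (Suc j)" using integral_prim_power[OF m, of 1 0 x j] True by simp
    finally show ?thesis using True prim_nonneg[OF m0 m True] by (simp add: prim_def[of g])
  next
    case False
    have "norm (integral {x..0} g) \<le> integral {x..0} (\<lambda>t. m t * ((-1 * prim m t) ^ j / fact j))"
    proof (rule integral_norm_bound_integral[OF loc_int_integrable[OF g] hint])
      fix t assume "t \<in> {x..0}"
      then show "norm (g t) \<le> m t * ((-1 * prim m t) ^ j / fact j)"
        using gle[of t] prim_nonpos[OF m0 m, of t] by simp
    qed
    also have "\<dots> = (- prim m x) ^ Suc j / fact (Suc j)" using integral_prim_power[OF m, of "-1" x 0 j] False by simp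
    finally show ?thesis using False prim_nonpos[OF m0 m, of x] by (simp add: prim_def[of g])
  qed
  then show ?case by (simp add: biv_A_Suc[OF u v] g_def[abs_def] m_def[abs_def])
qed simp

text \<open>Dominated convergence: all partial sums of the series are bounded by the locally
  integrable \<open>norm (f t) * exp \<bar>M t\<bar>\<close>.\<close>

lemma
  fixes a :: "nat \<Rightarrow> real \<Rightarrow> complex"
  assumes f: "loc_int f" and a: "\<And>j. continuous_on UNIV (a j)" and M: "continuous_on UNIV M"
    and le: "\<And>j x. norm (a j x) \<le> \<bar>M x\<bar> ^ j / fact j"
  shows loc_int_mult_suminf: "loc_int (\<lambda>t. f t * (\<Sum>j. a j t))"
    and prim_sums: "(\<lambda>j. prim (\<lambda>t. f t * a j t) x) sums prim (\<lambda>t. f t * (\<Sum>j. a j t)) x"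
proof -
  define h where "h t = norm (f t) * exp \<bar>M t\<bar>" for t
  have h: "loc_int h"
    unfolding h_def[abs_def] by (intro loc_int_mult_continuous loc_int_norm f continuous_intros M)
  have fa: "loc_int (\<lambda>t. f t * a j t)" for j by (rule loc_int_mult_continuous[OF f a])
  have p: "loc_int (\<lambda>t. \<Sum>j<n. f t * a j t)" for n
    unfolding loc_int_def by (intro allI absolutely_integrable_sum) (auto intro: loc_intD[OF fa])
  have exps: "(\<lambda>j. \<bar>M t\<bar> ^ j / fact j) sums exp \<bar>M t\<bar>" for t
    using exp_converges[of "\<bar>M t\<bar>"] by (simp add: divide_inverse mult.commute)
  have ple: "norm (\<Sum>j<n. f t * a j t) \<le> h t" for n t
  proof -
    have "norm (\<Sum>j<n. f t * a j t) \<le> (\<Sum>j<n. norm (f t) * (\<bar>M t\<bar> ^ j / fact j))"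
      by (intro sum_norm_le) (simp only: norm_mult, intro mult_left_mono le norm_ge_zero)
    also have "\<dots> = norm (f t) * (\<Sum>j<n. \<bar>M t\<bar> ^ j / fact j)" by (simp add: sum_distrib_left)
    also have "\<dots> \<le> h t"
      unfolding h_def using sum_le_suminf[OF sums_summable[OF exps[of t]], of "{..<n}"] sums_unique[OF exps[of t]]
      by (intro mult_left_mono) auto
    finally show ?thesis .
  qed
  have conv: "(\<lambda>n. \<Sum>j<n. f t * a j t) \<longlonglongrightarrow> f t * (\<Sum>j. a j t)" for t
  proof -
    have "summable (\<lambda>j. a j t)"
      by (rule summable_comparison_test'[OF sums_summable[OF exps[of t]]]) (rule le)
    then show ?thesis using sums_mult[OF summable_sums] by (simp add: sums_def)
  qed
  have gle: "norm (f t * (\<Sum>j. a j t)) \<le> h t" for t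
    by (rule Lim_norm_ubound[OF _ conv]) (simp, intro always_eventually allI ple)
  show "loc_int (\<lambda>t. f t * (\<Sum>j. a j t))"
    unfolding loc_int_def
    by (intro allI dominated_convergence_absolutely_integrable[OF loc_intD[OF p] loc_int_integrable[OF h] gle conv])
  have "(\<lambda>n. integral {c..d} (\<lambda>t. \<Sum>j<n. f t * a j t)) \<longlonglongrightarrow> integral {c..d} (\<lambda>t. f t * (\<Sum>j. a j t))" for c d
    by (rule dominated_convergence(2)[OF loc_int_integrable[OF p] loc_int_integrable[OF h] ple conv])
  moreover have "integral {c..d} (\<lambda>t. \<Sum>j<n. f t * a j t) = (\<Sum>j<n. integral {c..d} (\<lambda>t. f t * a j t))" for c d n
    by (intro Henstock_Kurzweil_Integration.integral_sum loc_int_integrable[OF fa]) simp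
  ultimately have "(\<lambda>j. integral {c..d} (\<lambda>t. f t * a j t)) sums integral {c..d} (\<lambda>t. f t * (\<Sum>j. a j t))" for c d
    by (simp add: sums_def)
  then show "(\<lambda>j. prim (\<lambda>t. f t * a j t) x) sums prim (\<lambda>t. f t * (\<Sum>j. a j t)) x"
    unfolding prim_def by (auto intro: sums_minus)
qed

text \<open>Each of the \<open>j\<close> factors contributes one sign. Consequently
  \<open>biv_C\<close> and \<open>biv_S\<close> collect the terms of even and of odd index.\<close>

lemma biv_A_uminus:
  assumes u: "loc_int u" and v: "loc_int v"
  shows "biv_A j (\<lambda>t. - u t) (\<lambda>t. - v t) x = (-1) ^ j * biv_A j u v x"
proof (induction j arbitrary: x)
  case (Suc j)
  have u': "loc_int (\<lambda>t. - u t)" and v': "loc_int (\<lambda>t. - v t)"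
    using loc_int_linear[OF _ bounded_linear_minus[OF bounded_linear_ident]] u v by auto
  have "(\<lambda>t. biv_factor (\<lambda>t. - u t) (\<lambda>t. - v t) (Suc j) t * biv_A j (\<lambda>t. - u t) (\<lambda>t. - v t) t)
      = (\<lambda>t. (-1) ^ Suc j * (biv_factor u v (Suc j) t * biv_A j u v t))"
    by (auto simp: Suc.IH biv_factor_def)
  then have "biv_A (Suc j) (\<lambda>t. - u t) (\<lambda>t. - v t) x
      = prim (\<lambda>t. (-1) ^ Suc j * (biv_factor u v (Suc j) t * biv_A j u v t)) x"
    by (simp only: biv_A_Suc[OF u' v'])
  also have "\<dots> = (-1) ^ Suc j * biv_A (Suc j) u v x"
    by (simp only: prim_cmult biv_A_Suc[OF u v])
  finally show ?case .
qed simp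

text \<open>Padding with zeros keeps all indices, so that a shift by one together with one primitive
  exchanges \<open>biv_even\<close> and \<open>biv_odd\<close>.\<close>

definition biv_even :: "(real \<Rightarrow> complex) \<Rightarrow> (real \<Rightarrow> complex) \<Rightarrow> nat \<Rightarrow> real \<Rightarrow> complex" where
  "biv_even u v j x = (if even j then biv_A j u v x else 0)"

definition biv_odd :: "(real \<Rightarrow> complex) \<Rightarrow> (real \<Rightarrow> complex) \<Rightarrow> nat \<Rightarrow> real \<Rightarrow> complex" where
  "biv_odd u v j x = (if odd j then biv_A j u v x else 0)"

lemma summable_biv_A:
  assumes u: "loc_int u" and v: "loc_int v"
  shows "summable (\<lambda>j. biv_A j u v x)"
proof (rule summable_comparison_test')
  show "summable (\<lambda>j. \<bar>prim (\<lambda>t. norm (u t) + norm (v t)) x\<bar> ^ j / fact j)"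
    using summable_exp[of "\<bar>prim (\<lambda>t. norm (u t) + norm (v t)) x\<bar>"] by (simp add: divide_inverse mult.commute)
qed (rule norm_biv_A_le[OF u v])

lemma biv_CS_eq_suminf:
  assumes u: "loc_int u" and v: "loc_int v"
  shows "biv_C u v x = (\<Sum>j. biv_even u v j x)" and "biv_S u v x = (\<Sum>j. biv_odd u v j x)"
proof -
  note s = summable_biv_A[OF u v, of x]
  have u': "loc_int (\<lambda>t. - u t)" and v': "loc_int (\<lambda>t. - v t)"
    using loc_int_linear[OF _ bounded_linear_minus[OF bounded_linear_ident]] u v by auto
  have s': "summable (\<lambda>j. (-1) ^ j * biv_A j u v x)"
    using summable_biv_A[OF u' v', of x] by (simp only: biv_A_uminus[OF u v])
  have E: "(\<lambda>j. biv_A j u v x) sums biv_exp u v x"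
    using summable_sums[OF s] suminf_split_head[OF s] by (simp add: biv_exp_def)
  have E': "(\<lambda>j. (-1) ^ j * biv_A j u v x) sums biv_exp (\<lambda>t. - u t) (\<lambda>t. - v t) x"
    using summable_sums[OF s'] suminf_split_head[OF s'] by (simp add: biv_exp_def biv_A_uminus[OF u v])
  have "(\<lambda>j. (biv_A j u v x + (-1) ^ j * biv_A j u v x) / 2) sums biv_C u v x"
    unfolding biv_C_def by (intro sums_divide sums_add E E')
  moreover have "(\<lambda>j. (biv_A j u v x + (-1) ^ j * biv_A j u v x) / 2) = (\<lambda>j. biv_even u v j x)"
    by (auto simp: biv_even_def)
  ultimately show "biv_C u v x = (\<Sum>j. biv_even u v j x)" by (simp add: sums_iff)
  have "(\<lambda>j. (biv_A j u v x - (-1) ^ j * biv_A j u v x) / 2) sums biv_S u v x"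
    unfolding biv_S_def by (intro sums_divide sums_diff E E')
  moreover have "(\<lambda>j. (biv_A j u v x - (-1) ^ j * biv_A j u v x) / 2) = (\<lambda>j. biv_odd u v j x)"
    by (auto simp: biv_odd_def)
  ultimately show "biv_S u v x = (\<Sum>j. biv_odd u v j x)" by (simp add: sums_iff)
qed

text \<open>The last factor of \<open>A_j\<close> is \<open>v\<close> for even positive
  \<open>j\<close> and \<open>u\<close> for odd \<open>j\<close>. Summing the recursion over one
  parity gives \<open>C' = v S\<close> and \<open>S' = u C\<close>, here in integrated form.\<close>

lemma
  assumes u: "loc_int u" and v: "loc_int v"
  shows biv_C_eq_prim: "biv_C u v x = 1 + prim (\<lambda>t. v t * biv_S u v t) x"
    and biv_S_eq_prim: "biv_S u v x = prim (\<lambda>t. u t * biv_C u v t) x"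
    and loc_int_mult_biv_S: "loc_int f \<Longrightarrow> loc_int (\<lambda>t. f t * biv_S u v t)"
    and loc_int_mult_biv_C: "loc_int f \<Longrightarrow> loc_int (\<lambda>t. f t * biv_C u v t)"
proof -
  define M where "M = prim (\<lambda>t. norm (u t) + norm (v t))"
  have M: "continuous_on UNIV M"
    unfolding M_def by (intro AC_loc_continuous_on[OF prim_AC_loc] loc_int_add loc_int_norm u v)
  have e: "continuous_on UNIV (biv_even u v j)" "continuous_on UNIV (biv_odd u v j)" for j
    using continuous_on_biv_A[OF u v, of j] by (cases "even j"; simp add: biv_even_def[abs_def] biv_odd_def[abs_def])+
  have le: "norm (biv_even u v j t) \<le> \<bar>M t\<bar> ^ j / fact j" "norm (biv_odd u v j t) \<le> \<bar>M t\<bar> ^ j / fact j" for j t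
    using norm_biv_A_le[OF u v, of j t] by (auto simp: biv_even_def biv_odd_def M_def)
  note CS = biv_CS_eq_suminf[OF u v]
  show "loc_int (\<lambda>t. f t * biv_S u v t)" if "loc_int f"
    unfolding CS by (rule loc_int_mult_suminf[OF that e(2) M le(2)])
  show "loc_int (\<lambda>t. f t * biv_C u v t)" if "loc_int f"
    unfolding CS by (rule loc_int_mult_suminf[OF that e(1) M le(1)])
  have eS: "biv_even u v (Suc j) x = prim (\<lambda>t. v t * biv_odd u v j t) x"
    and oS: "biv_odd u v (Suc j) x = prim (\<lambda>t. u t * biv_even u v j t) x" for j
    by (cases "even j"; simp add: biv_even_def biv_odd_def biv_A_Suc[OF u v] biv_factor_def prim_def)+
  have "(\<lambda>j. biv_even u v (Suc j) x) sums prim (\<lambda>t. v t * biv_S u v t) x"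
    unfolding eS CS by (rule prim_sums[OF v e(2) M le(2)])
  \<comment> \<open>The term of index 0 lies outside the recursion; it equals 1 here and 0 in the
    odd case.\<close>
  then have "(\<lambda>j. biv_even u v j x) sums (prim (\<lambda>t. v t * biv_S u v t) x + biv_even u v 0 x)"
    by (subst (asm) sums_Suc_iff) simp
  then show "biv_C u v x = 1 + prim (\<lambda>t. v t * biv_S u v t) x"
    by (simp add: CS(1) sums_iff biv_even_def)
  have "(\<lambda>j. biv_odd u v (Suc j) x) sums prim (\<lambda>t. u t * biv_C u v t) x"
    unfolding oS CS by (rule prim_sums[OF u e(1) M le(1)])
  then have "(\<lambda>j. biv_odd u v j x) sums (prim (\<lambda>t. u t * biv_C u v t) x + biv_odd u v 0 x)"
    by (subst (asm) sums_Suc_iff) simp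
  then show "biv_S u v x = prim (\<lambda>t. u t * biv_C u v t) x"
    by (simp add: CS(2) sums_iff biv_odd_def)
qed

lemma Im_biv_A:
  assumes u: "loc_int u" "\<And>t. Im (u t) = 0" and v: "loc_int v" "\<And>t. Im (v t) = 0"
  shows "Im (biv_A j u v x) = 0"
proof (induction j arbitrary: x)
  case (Suc j)
  have "Im (biv_A (Suc j) u v x) = prim (\<lambda>t. Im (biv_factor u v (Suc j) t * biv_A j u v t)) x"
    unfolding biv_A_Suc[OF u(1) v(1)]
    by (rule prim_linear[symmetric, OF loc_int_biv_factor[OF u(1) v(1) continuous_on_biv_A[OF u(1) v(1)]] bounded_linear_Im])
  also have "(\<lambda>t. Im (biv_factor u v (Suc j) t * biv_A j u v t)) = (\<lambda>t. 0)"
    using u(2) v(2) by (auto simp: Suc.IH biv_factor_def)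
  finally show ?case by (simp add: prim_def)
qed simp

lemma Im_biv_CS:
  assumes u: "loc_int u" "\<And>t. Im (u t) = 0" and v: "loc_int v" "\<And>t. Im (v t) = 0"
  shows "Im (biv_C u v x) = 0" "Im (biv_S u v x) = 0"
proof -
  have u': "loc_int (\<lambda>t. - u t)" and v': "loc_int (\<lambda>t. - v t)"
    using loc_int_linear[OF _ bounded_linear_minus[OF bounded_linear_ident]] u v by auto
  have E: "Im (biv_exp a b x) = 0"
    if a: "loc_int a" "\<And>t. Im (a t) = 0" and b: "loc_int b" "\<And>t. Im (b t) = 0" for a b
  proof -
    have "summable (\<lambda>j. biv_A (Suc j) a b x)"
      using summable_biv_A[OF a(1) b(1)] by (subst summable_Suc_iff)
    from bounded_linear.suminf[OF bounded_linear_Im this] have "Im (\<Sum>j. biv_A (Suc j) a b x) = 0"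
      by (simp add: Im_biv_A[OF a b])
    then show ?thesis by (simp add: biv_exp_def)
  qed
  show "Im (biv_C u v x) = 0" "Im (biv_S u v x) = 0"
    using E[OF u v] E[OF u' _ v'] u(2) v(2) by (simp_all add: biv_C_def biv_S_def)
qed

section \<open>The Riccati equation in homogeneous coordinates\<close>

lemma loc_int_cmult:
  fixes f :: "real \<Rightarrow> 'a::{euclidean_space, real_normed_algebra}"
  shows "loc_int f \<Longrightarrow> loc_int (\<lambda>t. c * f t)"
  by (rule loc_int_linear[OF _ bounded_linear_mult_right])

text \<open>For continuous integrands the derivative exists at every point. This gives
  \<open>den\<close> the derivative \<open>num\<close> everywhere, as needed at its zeros.\<close>

lemma prim_has_real_derivative:
  fixes f :: "real \<Rightarrow> real"
  assumes f: "continuous_on UNIV f"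
  shows "(prim f has_real_derivative f x) (at x)"
proof -
  have fi: "loc_int f"
    unfolding loc_int_def using f by (auto intro!: absolutely_integrable_continuous_real elim: continuous_on_subset)
  have "((\<lambda>u. integral {x - 1..u} f) has_vector_derivative f x) (at x within {x - 1..x + 1})"
    using f by (intro integral_has_vector_derivative) (auto elim: continuous_on_subset)
  then have "((\<lambda>u. prim f (x - 1) + integral {x - 1..u} f) has_vector_derivative f x) (at x within {x - 1..x + 1})"
    by (intro derivative_eq_intros) auto
  then have "(prim f has_vector_derivative f x) (at x within {x - 1..x + 1})"
    by (rule has_vector_derivative_transform[rotated 2]) (use prim_diff[OF fi] in \<open>auto simp: algebra_simps\<close>)
  moreover have "at x within {x - 1..x + 1} = at x" by (rule at_within_interior) (auto simp: interior_atLeastAtMost_real)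
  ultimately show ?thesis by (simp add: has_real_derivative_iff_has_vector_derivative)
qed

lemma AC_loc_inverse:
  fixes f :: "real \<Rightarrow> real"
  assumes f: "f \<in> AC_loc UNIV" and pos: "\<And>x. f x > 0"
  shows "(\<lambda>x. inverse (f x)) \<in> AC_loc UNIV"
proof (rule AC_locI_Lipschitz2[OF f AC_loc_const[of "0::real"]])
  fix a b :: real
  obtain c where c: "c > 0" "\<And>x. x \<in> {a..b} \<Longrightarrow> c \<le> f x"
  proof (cases "a \<le> b")
    case True
    obtain z where "z \<in> {a..b}" "\<And>x. x \<in> {a..b} \<Longrightarrow> f z \<le> f x"
      using continuous_attains_inf[of "{a..b}" f] True AC_loc_continuous_on[OF f] by auto
    then show thesis using that pos by blast
  next
    case False then show thesis using that[of 1] by auto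
  qed
  have "dist (inverse (f x)) (inverse (f y)) \<le> inverse (c * c) * dist (f x) (f y)"
    if xy: "x \<in> {a..b}" "y \<in> {a..b}" for x y
  proof -
    have "inverse (f x) - inverse (f y) = inverse (f x * f y) * (f y - f x)"
      using pos[of x] pos[of y] by (simp add: field_simps)
    then have "dist (inverse (f x)) (inverse (f y)) = inverse (f x * f y) * dist (f x) (f y)"
      using pos[of x] pos[of y] by (simp add: dist_real_def abs_mult abs_minus_commute[of "f y" "f x"])
    also have "\<dots> \<le> inverse (c * c) * dist (f x) (f y)"
      using c xy by (intro mult_right_mono le_imp_inverse_le mult_mono) (auto intro: less_imp_le[OF pos])
    finally show ?thesis .
  qed
  then show "\<exists>K. \<forall>x\<in>{a..b}. \<forall>y\<in>{a..b}. dist (inverse (f x)) (inverse (f y)) \<le> K * (dist (f x) (f y) + dist (0::real) 0)"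
    by (intro exI[of _ "inverse (c * c)"]) auto
qed simp

lemma AC_loc_component:
  fixes f :: "real \<Rightarrow> real ^ 'n"
  assumes "f \<in> AC_loc S"
  shows "(\<lambda>x. f x $ i) \<in> AC_loc UNIV"
  by (rule AC_locI_Lipschitz2[OF assms AC_loc_const[of "0::real"]]) (auto intro!: exI[of _ 1] dist_vec_nth_le)

lemma stereographic_component:
  "stereographic None $ 1 = 0" "stereographic None $ 3 = 1"
  "stereographic (Some (complex_of_real a)) $ 1 = 2 * a / (a\<^sup>2 + 1)"
  "stereographic (Some (complex_of_real a)) $ 3 = (a\<^sup>2 - 1) / (a\<^sup>2 + 1)"
  by (simp_all add: stereographic_def)

section \<open>The linear system for numerator and denominator\<close>

locale miura =
  fixes q :: "real \<Rightarrow> complex" and y0 :: real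
  assumes q: "loc_int q" and Im_q: "\<And>t. Im (q t) = 0"
begin

definition cnum :: "real \<Rightarrow> complex" where
  "cnum x = complex_of_real y0 * biv_C (\<lambda>_. 1) q x + biv_S q (\<lambda>_. 1) x"

definition cden :: "real \<Rightarrow> complex" where
  "cden x = complex_of_real y0 * biv_S (\<lambda>_. 1) q x + biv_C q (\<lambda>_. 1) x"

definition num :: "real \<Rightarrow> real" where "num x = Re (cnum x)"
definition den :: "real \<Rightarrow> real" where "den x = Re (cden x)"
definition r :: "real \<Rightarrow> real" where "r x = Re (q x)"

lemma of_real_num: "cnum x = complex_of_real (num x)" and of_real_den: "cden x = complex_of_real (den x)"
  using Im_biv_CS[OF loc_int_const[of 1] _ q Im_q] Im_biv_CS[OF q Im_q loc_int_const[of 1]]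
  by (simp_all add: complex_eq_iff num_def den_def cnum_def cden_def)

lemma q_eq: "q x = complex_of_real (r x)"
  using Im_q by (simp add: complex_eq_iff r_def)

lemma miura_inverse_eq:
  "miura_inverse q y0 x = (if den x = 0 then None else Some (complex_of_real (num x / den x)))"
  unfolding miura_inverse_def cnum_def[symmetric] cden_def[symmetric] Let_def of_real_num of_real_den by simp

lemma r: "loc_int r"
  unfolding r_def[abs_def] by (rule loc_int_linear[OF q bounded_linear_Re])

lemmas loc1 = loc_int_const[of "1::complex"]

text \<open>The recursion with coefficients \<open>1, q\<close> and \<open>q, 1\<close> gives
  \<open>C_{1,q}' = q S_{1,q}\<close> and \<open>S_{q,1}' = q C_{q,1}\<close>, whose combination is
  \<open>q * cden\<close>. Likewise \<open>S_{1,q}' = C_{1,q}\<close> and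
  \<open>C_{q,1}' = S_{q,1}\<close> give \<open>cnum\<close> as derivative of
  \<open>cden\<close>.\<close>

lemma cnum: "cnum x = complex_of_real y0 + prim (\<lambda>t. q t * cden t) x" "loc_int (\<lambda>t. q t * cden t)"
proof -
  have l: "loc_int (\<lambda>t. complex_of_real y0 * (q t * biv_S (\<lambda>_. 1) q t))" "loc_int (\<lambda>t. q t * biv_C q (\<lambda>_. 1) t)"
    by (intro loc_int_cmult loc_int_mult_biv_S loc_int_mult_biv_C q loc1)+
  have e: "(\<lambda>t. q t * cden t) = (\<lambda>t. complex_of_real y0 * (q t * biv_S (\<lambda>_. 1) q t) + q t * biv_C q (\<lambda>_. 1) t)"
    by (simp add: cden_def algebra_simps)
  show "loc_int (\<lambda>t. q t * cden t)" unfolding e by (rule loc_int_add[OF l])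
  show "cnum x = complex_of_real y0 + prim (\<lambda>t. q t * cden t) x"
    unfolding e prim_add[OF l] prim_cmult cnum_def
    by (simp add: biv_C_eq_prim[OF loc1 q] biv_S_eq_prim[OF q loc1] distrib_left)
qed

lemma cden: "cden x = 1 + prim cnum x" "loc_int cnum"
proof -
  have l: "loc_int (\<lambda>t. complex_of_real y0 * (1 * biv_C (\<lambda>_. 1) q t))" "loc_int (\<lambda>t. 1 * biv_S q (\<lambda>_. 1) t)"
    by (intro loc_int_cmult loc_int_mult_biv_S loc_int_mult_biv_C q loc1)+
  have e: "cnum = (\<lambda>t. complex_of_real y0 * (1 * biv_C (\<lambda>_. 1) q t) + 1 * biv_S q (\<lambda>_. 1) t)"
    by (simp add: cnum_def[abs_def])
  show "loc_int cnum" unfolding e by (rule loc_int_add[OF l])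
  show "cden x = 1 + prim cnum x"
    unfolding e prim_add[OF l] prim_cmult unfolding cden_def
    unfolding biv_S_eq_prim[OF loc1 q] biv_C_eq_prim[OF q loc1] by simp
qed

lemma loc_int_num: "loc_int num"
  unfolding num_def[abs_def] by (rule loc_int_linear[OF cden(2) bounded_linear_Re])

lemma loc_int_r_den: "loc_int (\<lambda>t. r t * den t)"
  using loc_int_linear[OF cnum(2) bounded_linear_Re] by (simp add: q_eq of_real_den)

lemma num_eq: "num x = y0 + prim (\<lambda>t. r t * den t) x"
  using arg_cong[OF cnum(1), of Re] prim_linear[OF cnum(2) bounded_linear_Re]
  by (simp add: q_eq of_real_den num_def)

lemma den_eq: "den x = 1 + prim num x"
  using arg_cong[OF cden(1), of Re] prim_linear[OF cden(2) bounded_linear_Re]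
  by (simp add: den_def num_def[abs_def])

lemma num_AC: "num \<in> AC_loc UNIV"
proof -
  have "(\<lambda>x. y0 + prim (\<lambda>t. r t * den t) x) \<in> AC_loc UNIV"
    by (intro AC_loc_add AC_loc_const prim_AC_loc loc_int_r_den)
  then show ?thesis by (simp add: num_eq[symmetric])
qed

lemma den_AC: "den \<in> AC_loc UNIV"
proof -
  have "(\<lambda>x. 1 + prim num x) \<in> AC_loc UNIV"
    by (intro AC_loc_add AC_loc_const prim_AC_loc loc_int_num)
  then show ?thesis by (simp add: den_eq[symmetric])
qed

lemma den_deriv: "(den has_real_derivative num x) (at x)"
proof -
  have "((\<lambda>x. 1 + prim num x) has_real_derivative 0 + num x) (at x)"
    by (intro DERIV_add DERIV_const prim_has_real_derivative AC_loc_continuous_on[OF num_AC])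
  then show ?thesis by (simp add: den_eq[symmetric])
qed

lemma num_deriv: "AE x in lebesgue. (num has_real_derivative r x * den x) (at x)"
  using prim_has_vector_derivative_AE[OF loc_int_r_den]
proof eventually_elim
  case (elim x)
  then have "((\<lambda>x. y0 + prim (\<lambda>t. r t * den t) x) has_real_derivative 0 + r x * den x) (at x)"
    by (intro DERIV_add DERIV_const) (simp add: has_real_derivative_iff_has_vector_derivative)
  then show ?case by (simp add: num_eq[symmetric])
qed

lemma num_0: "num 0 = y0" and den_0: "den 0 = 1"
  by (simp_all add: num_eq den_eq)

section \<open>Common zeros and zeros of the denominator\<close>

definition weight :: "real \<Rightarrow> real" where "weight t = 1 + \<bar>r t\<bar>"

lemma weight: "loc_int weight"
  unfolding weight_def[abs_def] using loc_int_add[OF loc_int_const[of 1] loc_int_norm[OF r]] by simp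

text \<open>The derivative of \<open>n^2 + d^2\<close> is \<open>2 (1 + r) n d\<close>, and
  \<open>2 |n d| <= n^2 + d^2\<close>. A common zero at \<open>x\<close> would thus propagate back
  to 0, where \<open>den\<close> is 1.\<close>

lemma nonvanishing: "(num x)\<^sup>2 + (den x)\<^sup>2 > 0"
proof (rule ccontr)
  define F where "F x = num x * num x + den x * den x" for x
  assume "\<not> ?thesis"
  then have zero: "F x = 0"
    unfolding F_def power2_eq_square by (metis add_nonneg_nonneg order_le_less zero_le_square)
  have AC: "F \<in> AC_loc UNIV" unfolding F_def[abs_def] by (intro AC_loc_add AC_loc_mult num_AC den_AC)
  have "AE x in lebesgue. \<exists>D. (F has_real_derivative D) (at x) \<and> \<bar>D\<bar> \<le> weight x * F x"
    using num_deriv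
  proof eventually_elim
    case (elim x)
    have "(F has_real_derivative (r x * den x * num x + r x * den x * num x) + (num x * den x + num x * den x)) (at x)"
      unfolding F_def[abs_def] by (intro DERIV_add DERIV_mult elim den_deriv)
    moreover have "(r x * den x * num x + r x * den x * num x) + (num x * den x + num x * den x) = (1 + r x) * (2 * num x * den x)"
      by (simp add: algebra_simps)
    moreover have "\<bar>(1 + r x) * (2 * num x * den x)\<bar> \<le> weight x * F x"
      unfolding abs_mult[of "1 + r x"]
    proof (rule mult_mono)
      show "\<bar>2 * num x * den x\<bar> \<le> F x"
        unfolding F_def abs_le_iff
        using zero_le_square[of "num x - den x"] zero_le_square[of "num x + den x"] by (simp add: algebra_simps)
    qed (auto simp: weight_def)
    ultimately show ?case by auto
  qed
  from AC_loc_Gronwall_zero[OF AC weight this zero, of 0] have "F 0 = 0" by (simp add: F_def)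
  then show False using sum_squares_eq_zero_iff[of "num 0" "den 0"] by (simp add: F_def den_0)
qed

text \<open>At a zero of \<open>den\<close> its derivative \<open>num\<close> is nonzero by
  \<open>nonvanishing\<close>, so zeros are isolated: finitely many in each compact interval, hence
  countably many.\<close>

lemma negligible_den_zeros: "negligible {x. den x = 0}"
proof -
  have nl: "\<not> x islimpt {x. den x = 0}" for x
  proof
    assume lim: "x islimpt {x. den x = 0}"
    have "closed {x. den x = 0}"
      using AC_loc_continuous_on[OF den_AC] by (intro closed_Collect_eq) auto
    then have x: "den x = 0" using lim by (auto simp: closed_limpt)
    then have n: "num x \<noteq> 0" using nonvanishing[of x] by auto
    have "((\<lambda>y. (den y - den x) / (y - x)) \<longlongrightarrow> num x) (at x)"
      using den_deriv[of x] by (simp add: has_field_derivative_iff)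
    then have "\<forall>\<^sub>F y in at x. (den y - den x) / (y - x) \<noteq> 0" using n by (rule tendsto_imp_eventually_ne)
    then have "\<forall>\<^sub>F y in at x. y \<notin> {x. den x = 0}" by (rule eventually_mono) (use x in auto)
    moreover have "\<exists>\<^sub>F y in at x. y \<in> {x. den x = 0}"
      using lim by (simp add: islimpt_conv_frequently_at)
    ultimately show False by (simp add: frequently_def)
  qed
  have "finite ({- real n..real n} \<inter> {x. den x = 0})" for n
    using nl by (intro finite_not_islimpt_in_compact) auto
  then have "countable (\<Union>n. {- real n..real n} \<inter> {x. den x = 0})" by (intro countable_UN) (auto intro: countable_finite)
  moreover have "{x. den x = 0} \<subseteq> (\<Union>n. {- real n..real n} \<inter> {x. den x = 0})"
  proof
    fix x assume x: "x \<in> {x. den x = 0}"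
    obtain n where "\<bar>x\<bar> \<le> real n" using real_arch_simple by blast
    then have "x \<in> {- real n..real n}" by auto
    with x show "x \<in> (\<Union>n. {- real n..real n} \<inter> {x. den x = 0})" by blast
  qed
  ultimately have "countable {x. den x = 0}" by (rule countable_subset[rotated])
  then show ?thesis
    unfolding negligible_iff_null_sets by (intro null_sets_completionI countable_imp_null_set_lborel)
qed

text \<open>The homogeneous form of the projection: its denominator never vanishes, so the same
  formulas hold at the poles, where \<open>den x = 0\<close>.\<close>

lemma stereographic_miura_inverse:
  "stereographic (miura_inverse q y0 x) $ 1 = 2 * num x * den x * inverse ((num x)\<^sup>2 + (den x)\<^sup>2)"
  "stereographic (miura_inverse q y0 x) $ 2 = 0"
  "stereographic (miura_inverse q y0 x) $ 3 = ((num x)\<^sup>2 - (den x)\<^sup>2) * inverse ((num x)\<^sup>2 + (den x)\<^sup>2)"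
proof -
  define n d where "n = num x" and "d = den x"
  have W: "n\<^sup>2 + d\<^sup>2 \<noteq> 0" using nonvanishing[of x] unfolding n_def d_def by linarith
  have *: "2 * (n / d) / ((n / d)\<^sup>2 + 1) = 2 * n * d * inverse (n\<^sup>2 + d\<^sup>2)"
    "((n / d)\<^sup>2 - 1) / ((n / d)\<^sup>2 + 1) = (n\<^sup>2 - d\<^sup>2) * inverse (n\<^sup>2 + d\<^sup>2)" if d: "d \<noteq> 0"
  proof -
    have 1: "(n / d)\<^sup>2 + 1 = (n\<^sup>2 + d\<^sup>2) / d\<^sup>2" "(n / d)\<^sup>2 - 1 = (n\<^sup>2 - d\<^sup>2) / d\<^sup>2"
      using d by (simp_all add: power_divide add_divide_distrib diff_divide_distrib)
    show "((n / d)\<^sup>2 - 1) / ((n / d)\<^sup>2 + 1) = (n\<^sup>2 - d\<^sup>2) * inverse (n\<^sup>2 + d\<^sup>2)"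
      unfolding 1 using d by (simp add: divide_inverse)
    show "2 * (n / d) / ((n / d)\<^sup>2 + 1) = 2 * n * d * inverse (n\<^sup>2 + d\<^sup>2)"
      unfolding 1 using d by (simp add: divide_inverse power2_eq_square)
  qed
  show "stereographic (miura_inverse q y0 x) $ 1 = 2 * num x * den x * inverse ((num x)\<^sup>2 + (den x)\<^sup>2)"
    "stereographic (miura_inverse q y0 x) $ 3 = ((num x)\<^sup>2 - (den x)\<^sup>2) * inverse ((num x)\<^sup>2 + (den x)\<^sup>2)"
    unfolding miura_inverse_eq n_def[symmetric] d_def[symmetric]
    using W * by (auto simp: stereographic_component simp del: of_real_divide)
  show "stereographic (miura_inverse q y0 x) $ 2 = 0"
    unfolding miura_inverse_eq by (simp add: stereographic_def del: of_real_divide)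
qed

section \<open>Existence: the quotient is a solution\<close>

lemma stereographic_miura_inverse_AC: "(\<lambda>x. stereographic (miura_inverse q y0 x)) \<in> AC_loc (sphere 0 1)"
proof -
  have inv: "(\<lambda>x. inverse ((num x)\<^sup>2 + (den x)\<^sup>2)) \<in> AC_loc UNIV"
    by (intro AC_loc_inverse AC_loc_add AC_loc_power num_AC den_AC nonvanishing)
  have "(\<lambda>x. 2 * num x * den x * inverse ((num x)\<^sup>2 + (den x)\<^sup>2)) \<in> AC_loc UNIV"
    by (intro AC_loc_mult AC_loc_const num_AC den_AC inv)
  then have 1: "(\<lambda>x. stereographic (miura_inverse q y0 x) $ 1) \<in> AC_loc UNIV"
    by (simp add: stereographic_miura_inverse)
  have "(\<lambda>x. ((num x)\<^sup>2 + (-1) * (den x)\<^sup>2) * inverse ((num x)\<^sup>2 + (den x)\<^sup>2)) \<in> AC_loc UNIV"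
    by (intro AC_loc_mult AC_loc_add AC_loc_power AC_loc_const num_AC den_AC inv)
  then have 3: "(\<lambda>x. stereographic (miura_inverse q y0 x) $ 3) \<in> AC_loc UNIV"
    by (simp add: stereographic_miura_inverse)
  show ?thesis
  proof (rule AC_locI_Lipschitz2[OF 1 3])
    show "range (\<lambda>x. stereographic (miura_inverse q y0 x)) \<subseteq> sphere 0 1"
    proof (rule image_subsetI)
      fix x
      define n d where "n = num x" and "d = den x"
      have W: "n\<^sup>2 + d\<^sup>2 \<noteq> 0" using nonvanishing[of x] unfolding n_def d_def by linarith
      define i where "i = inverse (n\<^sup>2 + d\<^sup>2)"
      have eq: "(2 * n * d)\<^sup>2 + (n\<^sup>2 - d\<^sup>2)\<^sup>2 = (n\<^sup>2 + d\<^sup>2)\<^sup>2" by (simp add: power2_eq_square algebra_simps)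
      have "(2 * n * d * i)\<^sup>2 + ((n\<^sup>2 - d\<^sup>2) * i)\<^sup>2 = ((2 * n * d)\<^sup>2 + (n\<^sup>2 - d\<^sup>2)\<^sup>2) * i\<^sup>2"
        by (simp only: power_mult_distrib distrib_right)
      also have "\<dots> = ((n\<^sup>2 + d\<^sup>2) * i)\<^sup>2" unfolding eq by (rule power_mult_distrib[symmetric])
      also have "\<dots> = 1" using W by (simp add: i_def)
      finally have one: "(2 * n * d * i)\<^sup>2 + ((n\<^sup>2 - d\<^sup>2) * i)\<^sup>2 = 1" .
      define p where "p = stereographic (miura_inverse q y0 x)"
      have "p $ 1 = 2 * n * d * i" "p $ 2 = 0" "p $ 3 = (n\<^sup>2 - d\<^sup>2) * i"
        unfolding p_def n_def d_def i_def by (rule stereographic_miura_inverse)+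
      moreover have "p \<bullet> p = (p $ 1)\<^sup>2 + (p $ 2)\<^sup>2 + (p $ 3)\<^sup>2"
        by (simp add: inner_vec_def sum_3 power2_eq_square)
      ultimately have "p \<bullet> p = 1" using one by (simp only: zero_power2 add_0_right)
      then have "norm p = 1" by (rule norm_eq_1[THEN iffD2])
      then show "stereographic (miura_inverse q y0 x) \<in> sphere 0 1" by (simp add: p_def)
    qed
    fix a b
    \<comment> \<open>The second coordinate vanishes, so the Euclidean distance is at most the sum
      of the differences in the other two.\<close>
    have "dist (stereographic (miura_inverse q y0 x)) (stereographic (miura_inverse q y0 y))
      \<le> 1 * (dist (stereographic (miura_inverse q y0 x) $ 1) (stereographic (miura_inverse q y0 y) $ 1)
        + dist (stereographic (miura_inverse q y0 x) $ 3) (stereographic (miura_inverse q y0 y) $ 3))" for x y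
      using norm_le_l1_cart[of "stereographic (miura_inverse q y0 x) - stereographic (miura_inverse q y0 y)"]
      by (simp add: dist_norm sum_3 stereographic_miura_inverse(2))
    then show "\<exists>K. \<forall>x\<in>{a..b}. \<forall>y\<in>{a..b}. dist (stereographic (miura_inverse q y0 x)) (stereographic (miura_inverse q y0 y))
      \<le> K * (dist (stereographic (miura_inverse q y0 x) $ 1) (stereographic (miura_inverse q y0 y) $ 1)
        + dist (stereographic (miura_inverse q y0 x) $ 3) (stereographic (miura_inverse q y0 y) $ 3))"
      by (intro exI[of _ 1] ballI)
  qed
qed

lemma miura_solution_miura_inverse: "miura_solution q y0 (miura_inverse q y0)"
  unfolding miura_solution_def
proof (intro conjI stereographic_miura_inverse_AC)
  show "range (miura_inverse q y0) \<subseteq> extended_reals"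
    by (auto simp: miura_inverse_eq extended_reals_def simp del: of_real_divide)
  show "miura_inverse q y0 0 = Some (complex_of_real y0)" by (simp add: miura_inverse_eq num_0 den_0)
  have "AE x in lebesgue. x \<notin> {x. den x = 0}"
    using negligible_den_zeros by (intro AE_not_in) (simp add: negligible_iff_null_sets)
  with num_deriv show "AE x in lebesgue. \<exists>w d. miura_inverse q y0 x = Some w \<and>
      has_derivative_on_sphere (miura_inverse q y0) d x \<and> q x = w\<^sup>2 + d"
  proof eventually_elim
    case (elim x)
    then have nz: "den x \<noteq> 0" by simp
    have "isCont den x" using den_deriv by (rule DERIV_isCont)
    then have "(den \<longlongrightarrow> den x) (nhds x)"
      by (simp add: isCont_def tendsto_at_iff_tendsto_nhds)
    then have ev: "\<forall>\<^sub>F t in nhds x. den t \<noteq> 0" using nz by (rule tendsto_imp_eventually_ne)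
    then have evN: "\<forall>\<^sub>F t in nhds x. miura_inverse q y0 t \<noteq> None"
      by (rule eventually_mono) (simp add: miura_inverse_eq)
    define D where "D = (r x * den x * den x - num x * num x) / (den x * den x)"
    have D: "((\<lambda>t. num t / den t) has_real_derivative D) (at x)"
      unfolding D_def by (rule DERIV_divide[OF elim(1) den_deriv nz])
    have "((\<lambda>t. complex_of_real (num t / den t)) has_vector_derivative complex_of_real D) (at x)"
      using has_vector_derivative_of_real[OF D] .
    moreover have "\<forall>\<^sub>F t in nhds x. complex_of_real (num t / den t) = the (miura_inverse q y0 t)"
      using ev by (rule eventually_mono) (simp add: miura_inverse_eq)
    ultimately have "((\<lambda>t. the (miura_inverse q y0 t)) has_vector_derivative complex_of_real D) (at x)"
      by (subst has_vector_derivative_cong_ev[symmetric]) (auto simp: miura_inverse_eq nz elim: eventually_mono)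
    then have hd: "has_derivative_on_sphere (miura_inverse q y0) (complex_of_real D) x"
      using evN by (simp add: has_derivative_on_sphere_def)
    have "D = r x - (num x / den x)\<^sup>2"
    proof -
      have "r x * den x * den x / (den x * den x) = r x" using nz by simp
      then show ?thesis unfolding D_def diff_divide_distrib power2_eq_square times_divide_times_eq by (rule arg_cong)
    qed
    then have rx: "r x = (num x / den x)\<^sup>2 + D" by linarith
    have "q x = complex_of_real (r x)" by (rule q_eq)
    also have "\<dots> = complex_of_real ((num x / den x)\<^sup>2 + D)" by (rule arg_cong[OF rx])
    also have "\<dots> = complex_of_real ((num x / den x)\<^sup>2) + complex_of_real D" by (rule of_real_add)
    also have "complex_of_real ((num x / den x)\<^sup>2) = (complex_of_real (num x / den x))\<^sup>2" by (rule of_real_power)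
    finally have qq: "q x = (complex_of_real (num x / den x))\<^sup>2 + complex_of_real D" .
    have mi: "miura_inverse q y0 x = Some (complex_of_real (num x / den x))"
      unfolding miura_inverse_eq by (rule if_not_P[OF nz])
    show ?case
      by (rule exI[of _ "complex_of_real (num x / den x)"], rule exI[of _ "complex_of_real D"], intro conjI mi hd qq)
  qed
qed

section \<open>Uniqueness\<close>

text \<open>The function \<open>F\<close> below is the squared chordal distance from \<open>\<alpha>\<close> to \<open>num / den\<close>, up to a positive
  factor. Written in the coordinates of \<open>\<S> \<alpha>\<close>, it is absolutely continuous even where \<open>\<alpha> = \<infinity>\<close>.\<close>
lemma miura_solution_unique:
  assumes sol: "miura_solution q y0 \<alpha>"
  shows "\<alpha> = miura_inverse q y0"
proof
  fix x
  have real: "\<alpha> t = None \<or> \<alpha> t = Some (complex_of_real (Re (the (\<alpha> t))))" for t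
  proof -
    have "\<alpha> t \<in> extended_reals" using sol by (auto simp: miura_solution_def)
    then show ?thesis by (auto simp: extended_reals_def)
  qed
  \<comment> \<open>At \<infinity> the value of \<open>a\<close> is arbitrary; it is used only where
    \<alpha> is finite.\<close>
  define a where "a t = Re (the (\<alpha> t))" for t
  define S1 where "S1 t = stereographic (\<alpha> t) $ 1" for t
  define S3 where "S3 t = stereographic (\<alpha> t) $ 3" for t
  have "(\<lambda>x. stereographic (\<alpha> x)) \<in> AC_loc (sphere 0 1)" using sol by (simp add: miura_solution_def)
  then have S: "S1 \<in> AC_loc UNIV" "S3 \<in> AC_loc UNIV"
    unfolding S1_def[abs_def] S3_def[abs_def] by (rule AC_loc_component)+
  \<comment> \<open>With \<open>p = a^2 + 1\<close>, the coordinates satisfy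
    \<open>(1 + S3) / 2 = a^2 / p\<close>, \<open>S1 = 2 a / p\<close> and
    \<open>(1 - S3) / 2 = 1 / p\<close>. These are the coefficients in the expansion of
    \<open>(a d - n)^2 / p\<close>.\<close>
  define F where "F t = (den t)\<^sup>2 * ((1/2) * (1 + S3 t)) + (-1) * (den t * num t * S1 t) + (num t)\<^sup>2 * ((1/2) * (1 + (-1) * S3 t))" for t
  have AC: "F \<in> AC_loc UNIV"
    unfolding F_def[abs_def] by (intro AC_loc_add AC_loc_mult AC_loc_power AC_loc_const S num_AC den_AC)
  have FNone: "F t = (den t)\<^sup>2" if "\<alpha> t = None" for t
    by (simp add: F_def S1_def S3_def that stereographic_component)
  have FSome: "F t = (a t * den t - num t) * (a t * den t - num t) / (a t * a t + 1)" if nN: "\<alpha> t \<noteq> None" for t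
  proof -
    define b d n p where "b = a t" and "d = den t" and "n = num t" and "p = b * b + 1"
    have p: "p \<noteq> 0" using zero_le_square[of b] unfolding p_def by linarith
    have at: "\<alpha> t = Some (complex_of_real b)" using real[of t] nN by (simp add: a_def b_def)
    have S1: "S1 t = 2 * b / p" and S3: "S3 t = (p - 2) / p"
      unfolding S1_def S3_def at stereographic_component p_def power2_eq_square by simp_all
    have h: "(1/2) * (1 + (p - 2) / p) = (p - 1) / p" "(1/2) * (1 + (-1) * ((p - 2) / p)) = 1 / p"
      using p by (simp_all add: field_simps)
    have "F t = (d\<^sup>2 * (p - 1) + (-1) * (d * n * (2 * b)) + n\<^sup>2) / p"
      unfolding F_def S1 S3 h d_def[symmetric] n_def[symmetric]
      by (simp only: times_divide_eq_right add_divide_distrib mult_1_right)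
    also have "d\<^sup>2 * (p - 1) + (-1) * (d * n * (2 * b)) + n\<^sup>2 = (b * d - n) * (b * d - n)"
      by (simp add: p_def power2_eq_square algebra_simps)
    finally show ?thesis by (simp only: p_def b_def d_def n_def)
  qed
  have nonneg: "F t \<ge> 0" for t
    using FNone[of t] FSome[of t] by (cases "\<alpha> t = None") simp_all
  have "\<alpha> 0 = Some (complex_of_real y0)" using sol by (simp add: miura_solution_def)
  then have zero: "F 0 = 0" using FSome[of 0] by (simp add: a_def num_0 den_0)
  have "AE x in lebesgue. \<exists>w d. \<alpha> x = Some w \<and> has_derivative_on_sphere \<alpha> d x \<and> q x = w\<^sup>2 + d"
    using sol by (simp add: miura_solution_def)
  with num_deriv have "AE x in lebesgue. \<exists>D. (F has_real_derivative D) (at x) \<and> \<bar>D\<bar> \<le> weight x * F x"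
  proof eventually_elim
    case (elim x)
    then obtain w d where w: "\<alpha> x = Some w" and d: "has_derivative_on_sphere \<alpha> d x" and qx: "q x = w\<^sup>2 + d" by blast
    have wa: "w = complex_of_real (a x)" using real[of x] w by (simp add: a_def)
    have ev: "\<forall>\<^sub>F t in nhds x. \<alpha> t \<noteq> None" and dv: "((\<lambda>t. the (\<alpha> t)) has_vector_derivative d) (at x)"
      using d by (simp_all add: has_derivative_on_sphere_def)
    have a': "(a has_real_derivative Re d) (at x)"
      unfolding a_def[abs_def] has_real_derivative_iff_has_vector_derivative
      by (rule bounded_linear.has_vector_derivative[OF bounded_linear_Re dv])
    have "r x = Re (w * w) + Re d" unfolding r_def qx power2_eq_square by simp
    also have "Re (w * w) = a x * a x" unfolding wa by simp
    finally have rd: "Re d = r x - a x * a x" by linarith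
    define e p b where "e = a x * den x - num x" and "p = a x * a x + 1" and "b = a x"
    have p: "p > 0" using zero_le_square[of "a x"] unfolding p_def by linarith
    have Fx: "F x = e * e / p" using FSome[of x] w by (simp add: e_def p_def)
    define E where "E = Re d * den x + num x * a x - r x * den x"
    have dE: "((\<lambda>t. a t * den t - num t) has_real_derivative E) (at x)"
      unfolding E_def by (rule DERIV_diff[OF DERIV_mult[OF a' den_deriv] elim(1)])
    have dP: "((\<lambda>t. a t * a t + 1) has_real_derivative Re d * a x + Re d * a x + 0) (at x)"
      by (rule DERIV_add[OF DERIV_mult[OF a' a'] DERIV_const])
    have D1: "((\<lambda>t. (a t * den t - num t) * (a t * den t - num t) / (a t * a t + 1)) has_real_derivative
        ((E * e + E * e) * p - (e * e) * (Re d * a x + Re d * a x + 0)) / (p * p)) (at x)"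
      unfolding e_def p_def by (rule DERIV_divide[OF DERIV_mult[OF dE dE] dP]) (use p in \<open>simp add: p_def\<close>)
    \<comment> \<open>The equation for \<alpha> gives \<open>E = - a e\<close>. In the quotient rule
      the terms of higher order in \<open>a\<close> cancel and leave the factor
      \<open>2 a / p\<close>, of modulus at most 1 however close a pole is.\<close>
    have D2: "((E * e + E * e) * p - (e * e) * (Re d * a x + Re d * a x + 0)) / (p * p)
        = - (2 * a x / p) * ((1 + r x) * F x)"
    proof -
      have E: "E = - (b * e)"
        unfolding E_def rd e_def b_def power2_eq_square by (simp add: algebra_simps)
      have "(E * e + E * e) * p - (e * e) * (Re d * a x + Re d * a x + 0) = - (2 * b) * ((1 + r x) * (e * e))"
        unfolding E rd p_def b_def[symmetric] power2_eq_square by (simp add: algebra_simps)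
      then show ?thesis unfolding Fx b_def[symmetric] by simp
    qed
    have "\<forall>\<^sub>F t in nhds x. (a t * den t - num t) * (a t * den t - num t) / (a t * a t + 1) = F t"
      using ev by (rule eventually_mono) (rule FSome[symmetric])
    from DERIV_cong_ev[OF refl this refl, THEN iffD1, OF D1]
    have D: "(F has_real_derivative - (2 * a x / p) * ((1 + r x) * F x)) (at x)" unfolding D2 .
    have "\<bar>2 * a x / p\<bar> \<le> 1"
    proof -
      have "0 \<le> (a x - 1) * (a x - 1)" "0 \<le> (a x + 1) * (a x + 1)" by (rule zero_le_square)+
      then have "2 * a x \<le> p" "- (2 * a x) \<le> p" unfolding p_def by (simp_all add: algebra_simps)
      then have "\<bar>2 * a x\<bar> \<le> p" by linarith
      then show ?thesis using p by (simp add: abs_divide)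
    qed
    then have "\<bar>2 * a x / p\<bar> * \<bar>(1 + r x) * F x\<bar> \<le> 1 * \<bar>(1 + r x) * F x\<bar>" by (intro mult_right_mono) auto
    also have "\<dots> = \<bar>1 + r x\<bar> * F x" using nonneg[of x] by (simp add: abs_mult)
    also have "\<dots> \<le> weight x * F x" using nonneg[of x] by (intro mult_right_mono) (auto simp: weight_def)
    finally have "\<bar>- (2 * a x / p) * ((1 + r x) * F x)\<bar> \<le> weight x * F x" by (simp only: abs_mult abs_minus_cancel)
    with D show ?case by blast
  qed
  then have Fx: "F x = 0" by (rule AC_loc_Gronwall_zero[OF AC weight _ zero nonneg])
  show "\<alpha> x = miura_inverse q y0 x"
  \<comment> \<open>At a pole \<open>F x = 0\<close> says that \<open>den\<close> vanishes. At a
    finite value it says \<open>num = a den\<close>, and then \<open>den = 0\<close> would force a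
    common zero.\<close>
  proof (cases "\<alpha> x = None")
    case True
    then show ?thesis using Fx FNone[OF True] by (simp add: miura_inverse_eq)
  next
    case False
    have "a x * a x + 1 \<noteq> 0" using zero_le_square[of "a x"] by linarith
    then have e: "num x = a x * den x" using Fx FSome[OF False] by simp
    then have "den x \<noteq> 0" using nonvanishing[of x] by auto
    then show ?thesis using real[of x] False e by (simp add: miura_inverse_eq a_def)
  qed
qed

end

theorem mainTheorem5:
  fixes q :: "real \<Rightarrow> complex" and y0 :: real
  assumes "locally_integrable q" and "\<forall>x. q x \<in> \<real>"
  shows "(\<exists>!\<alpha>. miura_solution q y0 \<alpha>) \<and>
         (\<forall>\<alpha>. miura_solution q y0 \<alpha> \<longrightarrow> \<alpha> = miura_inverse q y0)"
proof -
  interpret miura q y0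
    using assms by unfold_locales (auto simp: locally_integrable_def loc_int_def complex_is_Real_iff)
  show ?thesis using miura_solution_miura_inverse miura_solution_unique by blast
qed

end
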